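(* Let $\mathbb{C}$ be an exact category. Let $\mathsf{PreOrd}(\mathbb{C})$ be the category of internal preorders in $\mathbb{C}$, and let $\mathsf{Eq}(\mathbb{C})$ and $\mathsf{ParOrd}(\mathbb{C})$ be its full subcategories of internal equivalence relations and of internal partial orders in $\mathbb{C}$, respectively. Then the pair of full subcategories $(\mathsf{Eq}(\mathbb{C}), \mathsf{ParOrd}(\mathbb{C}))$ is a pretorsion theory in $\mathsf{PreOrd}(\mathbb{C})$ (with $\mathsf{Eq}(\mathbb{C})$ the torsion part and $\mathsf{ParOrd}(\mathbb{C})$ the torsion-free part).
   Context: Exact means Barr-exact: finitely complete, every morphism factors as a regular epimorphism followed by a monomorphism, regular epimorphisms are pullback-stable, and every internal equivalence relation is a kernel pair. Internal preorders. An object $(A,\rho)$ of $\mathsf{PreOrd}(\mathbb{C})$ is an object $A$ with a relation (subobject) $\langle r_1,r_2\rangle\colon \rho\to A\times A$ that is reflexive (it contains the diagonal $\Delta_A=\langle 1_A,1_A\rangle$) and transitive (there is $\tau\colon\rho\times_A\rho\to\rho$ with $r_1\tau=r_1p_1$, $r_2\tau=r_2p_2$, where $\rho\times_A\rho$ is the pullback of $r_2$ and $r_1$ with projections $p_1,p_2$). A morphism $(A,\rho)\to(B,\sigma)$ is a pair $(f\colon A\to B,\ \overline f\colon\rho\to\sigma)$ with $fr_1=s_1\overline f$ and $fr_2=s_2\overline f$, where $\langle s_1,s_2\rangle\colon\sigma\to B\times B$. Write $\rho^o=\langle r_2,r_1\rangle$ for the opposite relation. $(A,\rho)$ is an internal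 equivalence relation if $\rho^o=\rho$, and an internal partial order if $\rho\wedge\rho^o=\Delta_A$ (intersection of subobjects of $A\times A$). Pretorsion theories. Let $\mathbb{A}$ be a category, $\mathcal{T},\mathcal{F}$ full replete subcategories, and $\mathcal{Z}=\mathcal{T}\wedge\mathcal{F}$ the full subcategory of objects lying in both ("trivial objects"). Let $\mathcal{N}$ be the class of morphisms of $\mathbb{A}$ that factor through an object of $\mathcal{Z}$. An $\mathcal{N}$-kernel of $f\colon A\to B$ is a morphism $\kappa\colon K\to A$ such that $f\kappa\in\mathcal{N}$ and, for every $\lambda\colon X\to A$ with $f\lambda\in\mathcal{N}$, there is a unique $\lambda'\colon X\to K$ with $\lambda=\kappa\lambda'$; $\mathcal{N}$-cokernels are defined dually. A composable pair $A\xrightarrow{f}B\xrightarrow{g}C$ is a short $\mathcal{N}$-exact sequence if $f$ is an $\mathcal{N}$-kernel of $g$ and $g$ is an $\mathcal{N}$-cokernel of $f$. The pair $(\mathcal{T},\mathcal{F})$ is a pretorsion theory in $\mathbb{A}$ if: (1) every morphism $T\to F$ with $T\in\mathcal{T}$, $F\in\mathcal{F}$ belongs to $\mathcal{N}$; (2) for every object $A$ of $\mathbb{A}$ there is a short $\mathcal{N}$-exact sequence $T(A)\to A\to F(A)$ with $T(A)\in\mathcal{T}$ and $F(A)\in\mathcal{F}$. In the present case, $\mathcal{Z}=\mathsf{Eq}(\mathbb{C})\wedge\mathsf{ParOrd}(\mathbb{C})$ consists of the discrete preorders $(A,\Delta_A)$. *)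

theory Defs
  imports Main
begin

section \<open>Categories\<close>

text \<open>Carriers are sets, and nothing is required of \<open>Comp\<close> on non-composable pairs.
  Composition is written in the usual order: \<open>g \<cdot> f\<close> is ``first \<open>f\<close>, then \<open>g\<close>''.\<close>

record ('o, 'a) cat =
  Ob :: "'o set"
  Ar :: "'a set"
  Dom :: "'a \<Rightarrow> 'o"
  Cod :: "'a \<Rightarrow> 'o"
  Id :: "'o \<Rightarrow> 'a"
  Comp :: "'a \<Rightarrow> 'a \<Rightarrow> 'a"  (infixr "\<cdot>\<index>" 70)

definition hom :: "('o, 'a) cat \<Rightarrow> 'o \<Rightarrow> 'o \<Rightarrow> 'a set" where
  "hom C X Y = {f \<in> Ar C. Dom C f = X \<and> Cod C f = Y}"

locale category =
  fixes C :: "('o, 'a) cat" (structure)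
  assumes Dom_Ob: "f \<in> Ar C \<Longrightarrow> Dom C f \<in> Ob C"
    and Cod_Ob: "f \<in> Ar C \<Longrightarrow> Cod C f \<in> Ob C"
    and Id_hom: "X \<in> Ob C \<Longrightarrow> Id C X \<in> hom C X X"
    and Comp_hom: "\<lbrakk>f \<in> hom C X Y; g \<in> hom C Y Z\<rbrakk> \<Longrightarrow> g \<cdot> f \<in> hom C X Z"
    and Comp_Id: "f \<in> hom C X Y \<Longrightarrow> f \<cdot> Id C X = f"
    and Id_Comp: "f \<in> hom C X Y \<Longrightarrow> Id C Y \<cdot> f = f"
    and Comp_assoc: "\<lbrakk>f \<in> hom C W X; g \<in> hom C X Y; h \<in> hom C Y Z\<rbrakk>
      \<Longrightarrow> (h \<cdot> g) \<cdot> f = h \<cdot> (g \<cdot> f)"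

definition isomorphic :: "('o, 'a) cat \<Rightarrow> 'o \<Rightarrow> 'o \<Rightarrow> bool" where
  "isomorphic C X Y \<longleftrightarrow> (\<exists>f\<in>hom C X Y. \<exists>g\<in>hom C Y X.
     g \<cdot>\<^bsub>C\<^esub> f = Id C X \<and> f \<cdot>\<^bsub>C\<^esub> g = Id C Y)"

definition monic :: "('o, 'a) cat \<Rightarrow> 'a \<Rightarrow> bool" where
  "monic C m \<longleftrightarrow> m \<in> Ar C \<and>
     (\<forall>X. \<forall>f\<in>hom C X (Dom C m). \<forall>g\<in>hom C X (Dom C m).
        m \<cdot>\<^bsub>C\<^esub> f = m \<cdot>\<^bsub>C\<^esub> g \<longrightarrow> f = g)"


section \<open>Limits and colimits\<close>

definition is_functor ::
  "('i, 'j) cat \<Rightarrow> ('o, 'a) cat \<Rightarrow> ('i \<Rightarrow> 'o) \<Rightarrow> ('j \<Rightarrow> 'a) \<Rightarrow> bool" where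
  "is_functor J C FO FA \<longleftrightarrow>
     (\<forall>i\<in>Ob J. FO i \<in> Ob C) \<and>
     (\<forall>u\<in>Ar J. FA u \<in> hom C (FO (Dom J u)) (FO (Cod J u))) \<and>
     (\<forall>i\<in>Ob J. FA (Id J i) = Id C (FO i)) \<and>
     (\<forall>u\<in>Ar J. \<forall>v\<in>Ar J. Cod J u = Dom J v \<longrightarrow>
        FA (v \<cdot>\<^bsub>J\<^esub> u) = FA v \<cdot>\<^bsub>C\<^esub> FA u)"

definition is_cone ::
  "('i, 'j) cat \<Rightarrow> ('o, 'a) cat \<Rightarrow> ('i \<Rightarrow> 'o) \<Rightarrow> ('j \<Rightarrow> 'a) \<Rightarrow> 'o \<Rightarrow> ('i \<Rightarrow> 'a) \<Rightarrow> bool" where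
  "is_cone J C FO FA L p \<longleftrightarrow>
     L \<in> Ob C \<and> (\<forall>i\<in>Ob J. p i \<in> hom C L (FO i)) \<and>
     (\<forall>u\<in>Ar J. FA u \<cdot>\<^bsub>C\<^esub> p (Dom J u) = p (Cod J u))"

definition is_limit ::
  "('i, 'j) cat \<Rightarrow> ('o, 'a) cat \<Rightarrow> ('i \<Rightarrow> 'o) \<Rightarrow> ('j \<Rightarrow> 'a) \<Rightarrow> 'o \<Rightarrow> ('i \<Rightarrow> 'a) \<Rightarrow> bool" where
  "is_limit J C FO FA L p \<longleftrightarrow>
     is_cone J C FO FA L p \<and>
     (\<forall>X x. is_cone J C FO FA X x \<longrightarrow>
        (\<exists>!u. u \<in> hom C X L \<and> (\<forall>i\<in>Ob J. p i \<cdot>\<^bsub>C\<^esub> u = x i)))"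

text \<open>Every finite category is isomorphic to one whose objects and arrows are natural numbers,
  so shapes of type \<open>(nat, nat) cat\<close> suffice.\<close>

definition finitely_complete :: "('o, 'a) cat \<Rightarrow> bool" where
  "finitely_complete C \<longleftrightarrow>
     (\<forall>(J :: (nat, nat) cat) FO FA.
        category J \<and> finite (Ob J) \<and> finite (Ar J) \<and> is_functor J C FO FA \<longrightarrow>
        (\<exists>L p. is_limit J C FO FA L p))"

definition is_product :: "('o, 'a) cat \<Rightarrow> 'o \<Rightarrow> 'o \<Rightarrow> 'a \<Rightarrow> 'a \<Rightarrow> bool" where
  "is_product C A B p q \<longleftrightarrow>
     p \<in> Ar C \<and> q \<in> Ar C \<and> Dom C p = Dom C q \<and> Cod C p = A \<and> Cod C q = B \<and>
     (\<forall>X. \<forall>f\<in>hom C X A. \<forall>g\<in>hom C X B.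
        \<exists>!u. u \<in> hom C X (Dom C p) \<and> p \<cdot>\<^bsub>C\<^esub> u = f \<and> q \<cdot>\<^bsub>C\<^esub> u = g)"

text \<open>\<open>p\<close> and \<open>q\<close> are the projections of a pullback of \<open>f\<close> and \<open>g\<close>
  (so \<open>q\<close> is the pullback of \<open>f\<close> along \<open>g\<close>).\<close>

definition is_pullback :: "('o, 'a) cat \<Rightarrow> 'a \<Rightarrow> 'a \<Rightarrow> 'a \<Rightarrow> 'a \<Rightarrow> bool" where
  "is_pullback C f g p q \<longleftrightarrow>
     f \<in> Ar C \<and> g \<in> Ar C \<and> Cod C f = Cod C g \<and>
     p \<in> Ar C \<and> q \<in> Ar C \<and> Dom C p = Dom C q \<and> Cod C p = Dom C f \<and> Cod C q = Dom C g \<and>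
     f \<cdot>\<^bsub>C\<^esub> p = g \<cdot>\<^bsub>C\<^esub> q \<and>
     (\<forall>X. \<forall>x\<in>hom C X (Dom C f). \<forall>y\<in>hom C X (Dom C g).
        f \<cdot>\<^bsub>C\<^esub> x = g \<cdot>\<^bsub>C\<^esub> y \<longrightarrow>
        (\<exists>!u. u \<in> hom C X (Dom C p) \<and> p \<cdot>\<^bsub>C\<^esub> u = x \<and> q \<cdot>\<^bsub>C\<^esub> u = y))"

definition is_coequalizer :: "('o, 'a) cat \<Rightarrow> 'a \<Rightarrow> 'a \<Rightarrow> 'a \<Rightarrow> bool" where
  "is_coequalizer C f g e \<longleftrightarrow>
     f \<in> Ar C \<and> g \<in> Ar C \<and> Dom C f = Dom C g \<and> Cod C f = Cod C g \<and>
     e \<in> Ar C \<and> Dom C e = Cod C f \<and> e \<cdot>\<^bsub>C\<^esub> f = e \<cdot>\<^bsub>C\<^esub> g \<and>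
     (\<forall>Y. \<forall>h\<in>hom C (Cod C f) Y. h \<cdot>\<^bsub>C\<^esub> f = h \<cdot>\<^bsub>C\<^esub> g \<longrightarrow>
        (\<exists>!u. u \<in> hom C (Cod C e) Y \<and> u \<cdot>\<^bsub>C\<^esub> e = h))"

definition regular_epi :: "('o, 'a) cat \<Rightarrow> 'a \<Rightarrow> bool" where
  "regular_epi C e \<longleftrightarrow> (\<exists>f g. is_coequalizer C f g e)"

text \<open>Chosen binary products and pullbacks. They are meaningful only when the limit exists
  (always so below, where the ambient category is finitely complete); the notions built from them
  do not depend on the choice, except that the objects of \<open>PreOrd\<close> are
  written with respect to the chosen products, which changes \<open>PreOrd\<close> only up to isomorphism.\<close>

definition pr1 :: "('o, 'a) cat \<Rightarrow> 'o \<Rightarrow> 'o \<Rightarrow> 'a" where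
  "pr1 C A B = fst (SOME pq. is_product C A B (fst pq) (snd pq))"

definition pr2 :: "('o, 'a) cat \<Rightarrow> 'o \<Rightarrow> 'o \<Rightarrow> 'a" where
  "pr2 C A B = snd (SOME pq. is_product C A B (fst pq) (snd pq))"

definition prod_ob :: "('o, 'a) cat \<Rightarrow> 'o \<Rightarrow> 'o \<Rightarrow> 'o" where
  "prod_ob C A B = Dom C (pr1 C A B)"

definition pairing :: "('o, 'a) cat \<Rightarrow> 'a \<Rightarrow> 'a \<Rightarrow> 'a" where
  "pairing C f g = (THE h. h \<in> hom C (Dom C f) (prod_ob C (Cod C f) (Cod C g)) \<and>
     pr1 C (Cod C f) (Cod C g) \<cdot>\<^bsub>C\<^esub> h = f \<and> pr2 C (Cod C f) (Cod C g) \<cdot>\<^bsub>C\<^esub> h = g)"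

definition pb1 :: "('o, 'a) cat \<Rightarrow> 'a \<Rightarrow> 'a \<Rightarrow> 'a" where
  "pb1 C f g = fst (SOME pq. is_pullback C f g (fst pq) (snd pq))"

definition pb2 :: "('o, 'a) cat \<Rightarrow> 'a \<Rightarrow> 'a \<Rightarrow> 'a" where
  "pb2 C f g = snd (SOME pq. is_pullback C f g (fst pq) (snd pq))"


section \<open>Subobjects and internal relations\<close>

text \<open>Subobjects are handled through representing monomorphisms; equality of
  subobjects is mutual inclusion of representatives.\<close>

definition sub_le :: "('o, 'a) cat \<Rightarrow> 'a \<Rightarrow> 'a \<Rightarrow> bool" where
  "sub_le C m n \<longleftrightarrow> (\<exists>h\<in>hom C (Dom C m) (Dom C n). n \<cdot>\<^bsub>C\<^esub> h = m)"

definition sub_eq :: "('o, 'a) cat \<Rightarrow> 'a \<Rightarrow> 'a \<Rightarrow> bool" where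
  "sub_eq C m n \<longleftrightarrow> sub_le C m n \<and> sub_le C n m"

definition sub_inter :: "('o, 'a) cat \<Rightarrow> 'a \<Rightarrow> 'a \<Rightarrow> 'a" where
  "sub_inter C m n = m \<cdot>\<^bsub>C\<^esub> pb1 C m n"

text \<open>A relation on \<open>A\<close> is a monomorphism \<open>r\<close> into the chosen \<open>A \<times> A\<close>; the object called
  \<open>\<rho>\<close> in \<open>\<langle>r\<^sub>1, r\<^sub>2\<rangle> : \<rho> \<rightarrow> A \<times> A\<close> is \<open>Dom C r\<close>.\<close>

definition is_relation :: "('o, 'a) cat \<Rightarrow> 'o \<Rightarrow> 'a \<Rightarrow> bool" where
  "is_relation C A r \<longleftrightarrow> A \<in> Ob C \<and> monic C r \<and> Cod C r = prod_ob C A A"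

definition leg1 :: "('o, 'a) cat \<Rightarrow> 'o \<Rightarrow> 'a \<Rightarrow> 'a" where
  "leg1 C A r = pr1 C A A \<cdot>\<^bsub>C\<^esub> r"

definition leg2 :: "('o, 'a) cat \<Rightarrow> 'o \<Rightarrow> 'a \<Rightarrow> 'a" where
  "leg2 C A r = pr2 C A A \<cdot>\<^bsub>C\<^esub> r"

definition diag :: "('o, 'a) cat \<Rightarrow> 'o \<Rightarrow> 'a" where
  "diag C A = pairing C (Id C A) (Id C A)"

definition opp :: "('o, 'a) cat \<Rightarrow> 'o \<Rightarrow> 'a \<Rightarrow> 'a" where
  "opp C A r = pairing C (leg2 C A r) (leg1 C A r)"

definition reflexive_rel :: "('o, 'a) cat \<Rightarrow> 'o \<Rightarrow> 'a \<Rightarrow> bool" where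
  "reflexive_rel C A r \<longleftrightarrow> sub_le C (diag C A) r"

definition transitive_rel :: "('o, 'a) cat \<Rightarrow> 'o \<Rightarrow> 'a \<Rightarrow> bool" where
  "transitive_rel C A r \<longleftrightarrow>
     (let r1 = leg1 C A r; r2 = leg2 C A r; p1 = pb1 C r2 r1; p2 = pb2 C r2 r1 in
      \<exists>t\<in>hom C (Dom C p1) (Dom C r). r1 \<cdot>\<^bsub>C\<^esub> t = r1 \<cdot>\<^bsub>C\<^esub> p1 \<and> r2 \<cdot>\<^bsub>C\<^esub> t = r2 \<cdot>\<^bsub>C\<^esub> p2)"

definition internal_preorder :: "('o, 'a) cat \<Rightarrow> 'o \<Rightarrow> 'a \<Rightarrow> bool" where
  "internal_preorder C A r \<longleftrightarrow>
     is_relation C A r \<and> reflexive_rel C A r \<and> transitive_rel C A r"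

definition internal_equivalence :: "('o, 'a) cat \<Rightarrow> 'o \<Rightarrow> 'a \<Rightarrow> bool" where
  "internal_equivalence C A r \<longleftrightarrow> internal_preorder C A r \<and> sub_eq C (opp C A r) r"

definition internal_partial_order :: "('o, 'a) cat \<Rightarrow> 'o \<Rightarrow> 'a \<Rightarrow> bool" where
  "internal_partial_order C A r \<longleftrightarrow>
     internal_preorder C A r \<and> sub_eq C (sub_inter C r (opp C A r)) (diag C A)"


section \<open>Barr-exact categories\<close>

definition exact_category :: "('o, 'a) cat \<Rightarrow> bool" where
  "exact_category C \<longleftrightarrow>
     category C \<and>
     finitely_complete C \<and>
     (\<forall>f\<in>Ar C. \<exists>e m. regular_epi C e \<and> monic C m \<and> Dom C m = Cod C e \<and> f = m \<cdot>\<^bsub>C\<^esub> e) \<and>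
     (\<forall>e g p q. regular_epi C e \<and> is_pullback C e g p q \<longrightarrow> regular_epi C q) \<and>
     (\<forall>A r. internal_equivalence C A r \<longrightarrow>
        (\<exists>f. is_pullback C f f (leg1 C A r) (leg2 C A r)))"


section \<open>The category of internal preorders\<close>

text \<open>A morphism is a pair \<open>(f, fb)\<close>, recorded together with its source and target.\<close>

type_synonym ('o, 'a) preord_ob = "'o \<times> 'a"
type_synonym ('o, 'a) preord_ar =
  "('o, 'a) preord_ob \<times> ('a \<times> 'a) \<times> ('o, 'a) preord_ob"

definition preord_mor :: "('o, 'a) cat \<Rightarrow> ('o, 'a) preord_ob \<Rightarrow> 'a \<times> 'a \<Rightarrow>
    ('o, 'a) preord_ob \<Rightarrow> bool" where
  "preord_mor C = (\<lambda>(A, r) (f, fb) (B, s).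
     f \<in> hom C A B \<and> fb \<in> hom C (Dom C r) (Dom C s) \<and>
     f \<cdot>\<^bsub>C\<^esub> leg1 C A r = leg1 C B s \<cdot>\<^bsub>C\<^esub> fb \<and>
     f \<cdot>\<^bsub>C\<^esub> leg2 C A r = leg2 C B s \<cdot>\<^bsub>C\<^esub> fb)"

definition PreOrd :: "('o, 'a) cat \<Rightarrow> (('o, 'a) preord_ob, ('o, 'a) preord_ar) cat" where
  "PreOrd C = \<lparr>
     Ob = {(A, r). internal_preorder C A r},
     Ar = {(X, \<phi>, Y). (case X of (A, r) \<Rightarrow> internal_preorder C A r) \<and>
                      (case Y of (B, s) \<Rightarrow> internal_preorder C B s) \<and> preord_mor C X \<phi> Y},
     Dom = (\<lambda>(X, \<phi>, Y). X),
     Cod = (\<lambda>(X, \<phi>, Y). Y),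
     Id = (\<lambda>(A, r). ((A, r), (Id C A, Id C (Dom C r)), (A, r))),
     Comp = (\<lambda>(Y', (g, gb), Z) (X, (f, fb), Y). (X, (g \<cdot>\<^bsub>C\<^esub> f, gb \<cdot>\<^bsub>C\<^esub> fb), Z)) \<rparr>"

text \<open>A full subcategory is given by its class of objects.\<close>

definition Eq_sub :: "('o, 'a) cat \<Rightarrow> ('o, 'a) preord_ob set" where
  "Eq_sub C = {(A, r). internal_equivalence C A r}"

definition ParOrd_sub :: "('o, 'a) cat \<Rightarrow> ('o, 'a) preord_ob set" where
  "ParOrd_sub C = {(A, r). internal_partial_order C A r}"


section \<open>Pretorsion theories\<close>

definition replete_sub :: "('o, 'a) cat \<Rightarrow> 'o set \<Rightarrow> bool" where
  "replete_sub A T \<longleftrightarrow>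
     T \<subseteq> Ob A \<and> (\<forall>X\<in>T. \<forall>Y\<in>Ob A. isomorphic A X Y \<longrightarrow> Y \<in> T)"

definition trivial_ars :: "('o, 'a) cat \<Rightarrow> 'o set \<Rightarrow> 'a set" where
  "trivial_ars A Z = {f \<in> Ar A. \<exists>W\<in>Z. \<exists>h\<in>hom A (Dom A f) W. \<exists>k\<in>hom A W (Cod A f).
     f = k \<cdot>\<^bsub>A\<^esub> h}"

definition N_kernel :: "('o, 'a) cat \<Rightarrow> 'a set \<Rightarrow> 'a \<Rightarrow> 'a \<Rightarrow> bool" where
  "N_kernel A N f k \<longleftrightarrow>
     f \<in> Ar A \<and> k \<in> Ar A \<and> Cod A k = Dom A f \<and> f \<cdot>\<^bsub>A\<^esub> k \<in> N \<and>
     (\<forall>X. \<forall>l\<in>hom A X (Dom A f). f \<cdot>\<^bsub>A\<^esub> l \<in> N \<longrightarrow>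
        (\<exists>!l'. l' \<in> hom A X (Dom A k) \<and> l = k \<cdot>\<^bsub>A\<^esub> l'))"

definition N_cokernel :: "('o, 'a) cat \<Rightarrow> 'a set \<Rightarrow> 'a \<Rightarrow> 'a \<Rightarrow> bool" where
  "N_cokernel A N f c \<longleftrightarrow>
     f \<in> Ar A \<and> c \<in> Ar A \<and> Dom A c = Cod A f \<and> c \<cdot>\<^bsub>A\<^esub> f \<in> N \<and>
     (\<forall>Y. \<forall>l\<in>hom A (Cod A f) Y. l \<cdot>\<^bsub>A\<^esub> f \<in> N \<longrightarrow>
        (\<exists>!l'. l' \<in> hom A (Cod A c) Y \<and> l = l' \<cdot>\<^bsub>A\<^esub> c))"

definition short_N_exact :: "('o, 'a) cat \<Rightarrow> 'a set \<Rightarrow> 'a \<Rightarrow> 'a \<Rightarrow> bool" where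
  "short_N_exact A N f g \<longleftrightarrow> N_kernel A N g f \<and> N_cokernel A N f g"

definition pretorsion_theory :: "('o, 'a) cat \<Rightarrow> 'o set \<Rightarrow> 'o set \<Rightarrow> bool" where
  "pretorsion_theory A T F \<longleftrightarrow>
     category A \<and> replete_sub A T \<and> replete_sub A F \<and>
     (let N = trivial_ars A (T \<inter> F) in
       (\<forall>X\<in>T. \<forall>Y\<in>F. hom A X Y \<subseteq> N) \<and>
       (\<forall>X\<in>Ob A. \<exists>TX\<in>T. \<exists>FX\<in>F. \<exists>f\<in>hom A TX X. \<exists>g\<in>hom A X FX. short_N_exact A N f g))"

end

theory Submission
  imports Defs
begin

text \<open>We argue with generalized elements, writing \<open>x r y\<close> when \<open>\<langle>x, y\<rangle>\<close> factors through \<open>r\<close>.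
  For a preorder \<open>r\<close> on \<open>A\<close>, the equivalence relation \<open>e = r \<and> r\<^sup>o\<close> is the kernel pair of a
  regular epimorphism \<open>q : A \<rightarrow> B\<close>, and \<open>s\<close> is the regular image of \<open>r\<close> under \<open>q \<times> q\<close>. As \<open>r\<close> is
  saturated for \<open>e\<close>, one has \<open>q x s q y\<close> iff \<open>x r y\<close>. Regular epimorphisms are stable and relations
  descend along them, so every statement about \<open>s\<close> can be tested on elements of the form \<open>q x\<close>;
  thus \<open>s\<close> is a partial order. A morphism of preorders is trivial iff it identifies
  related elements, from which the universal properties of \<open>(A, e) \<rightarrow> (A, r) \<rightarrow> (B, s)\<close> follow.\<close>

section \<open>Regular epimorphisms and finite limits\<close>

context category
begin

lemma hom_Ob:
  assumes "f \<in> hom C X Y"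
  shows "X \<in> Ob C" "Y \<in> Ob C"
  using assms Dom_Ob Cod_Ob by (auto simp: hom_def)

lemma homD:
  assumes "f \<in> hom C X Y"
  shows "f \<in> Ar C" "Dom C f = X" "Cod C f = Y"
  using assms by (auto simp: hom_def)

lemma monic_cancel:
  assumes "monic C m" "m \<in> hom C Y Z" "f \<in> hom C X Y" "g \<in> hom C X Y" "m \<cdot> f = m \<cdot> g"
  shows "f = g"
  using assms by (auto simp: monic_def hom_def)

lemma regular_epi_hom:
  assumes "regular_epi C e"
  shows "e \<in> hom C (Dom C e) (Cod C e)"
  using assms by (auto simp: regular_epi_def is_coequalizer_def hom_def)

lemma regular_epi_coequalizer:
  assumes "regular_epi C e" "e \<in> hom C X Y"
  obtains a R b where "a \<in> hom C R X" "b \<in> hom C R X" "e \<cdot> a = e \<cdot> b"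
    "\<forall>Z. \<forall>h\<in>hom C X Z. h \<cdot> a = h \<cdot> b \<longrightarrow> (\<exists>!u. u \<in> hom C Y Z \<and> u \<cdot> e = h)"
proof -
  from assms(1) obtain a b where ab: "is_coequalizer C a b e"
    by (auto simp: regular_epi_def)
  then have "a \<in> hom C (Dom C a) X" "b \<in> hom C (Dom C a) X" "e \<cdot> a = e \<cdot> b"
    using assms(2) by (auto simp: is_coequalizer_def hom_def)
  moreover have "\<forall>Z. \<forall>h\<in>hom C X Z. h \<cdot> a = h \<cdot> b \<longrightarrow> (\<exists>!u. u \<in> hom C Y Z \<and> u \<cdot> e = h)"
    using ab unfolding is_coequalizer_def homD[OF assms(2)] by blast
  ultimately show thesis by (rule that)
qed

text \<open>\<open>f\<close> and \<open>g\<close> both factor \<open>f \<cdot> e\<close> through a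
  coequalizer, and such factorizations are unique. So regular epimorphisms are epic.\<close>

lemma regular_epi_cancel:
  assumes "regular_epi C e" "e \<in> hom C X Y" "f \<in> hom C Y Z" "g \<in> hom C Y Z" "f \<cdot> e = g \<cdot> e"
  shows "f = g"
proof -
  obtain a R b where ab: "a \<in> hom C R X" "b \<in> hom C R X" "e \<cdot> a = e \<cdot> b"
    and u: "\<forall>Z. \<forall>h\<in>hom C X Z. h \<cdot> a = h \<cdot> b \<longrightarrow> (\<exists>!u. u \<in> hom C Y Z \<and> u \<cdot> e = h)"
    by (rule regular_epi_coequalizer[OF assms(1,2)])
  have "(f \<cdot> e) \<cdot> a = (f \<cdot> e) \<cdot> b"
    using Comp_assoc[OF ab(1) assms(2,3)] Comp_assoc[OF ab(2) assms(2,3)] ab(3) by simp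
  then have "\<exists>!u. u \<in> hom C Y Z \<and> u \<cdot> e = f \<cdot> e"
    using u Comp_hom[OF assms(2,3)] by blast
  then show ?thesis using assms(3-5) by auto
qed

text \<open>Cancelling the mono \<open>m\<close> shows that \<open>k\<close> coequalizes the pair
  defining \<open>e\<close>, which induces \<open>d\<close> with \<open>d \<cdot> e = k\<close>. The
  triangle with \<open>h\<close> then follows by cancelling \<open>e\<close>. This fill-in is what
  lets relations descend along covers.\<close>

lemma regular_epi_strong:
  assumes e: "regular_epi C e" "e \<in> hom C X Y" and m: "monic C m" "m \<in> hom C R Z"
    and h: "h \<in> hom C Y Z" and k: "k \<in> hom C X R" and eq: "h \<cdot> e = m \<cdot> k"
  shows "\<exists>d\<in>hom C Y R. m \<cdot> d = h"
proof -
  obtain a S b where ab: "a \<in> hom C S X" "b \<in> hom C S X" "e \<cdot> a = e \<cdot> b"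
    and u: "\<forall>Z. \<forall>h\<in>hom C X Z. h \<cdot> a = h \<cdot> b \<longrightarrow> (\<exists>!u. u \<in> hom C Y Z \<and> u \<cdot> e = h)"
    by (rule regular_epi_coequalizer[OF e])
  have "m \<cdot> (k \<cdot> a) = m \<cdot> (k \<cdot> b)"
    using Comp_assoc[OF ab(1) e(2) h] Comp_assoc[OF ab(2) e(2) h] ab(3) eq
      Comp_assoc[OF ab(1) k m(2)] Comp_assoc[OF ab(2) k m(2)] by simp
  then have "k \<cdot> a = k \<cdot> b"
    by (rule monic_cancel[OF m Comp_hom[OF ab(1) k] Comp_hom[OF ab(2) k]])
  then obtain d where d: "d \<in> hom C Y R" "d \<cdot> e = k"
    using u k by blast
  have "(m \<cdot> d) \<cdot> e = h \<cdot> e"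
    using Comp_assoc[OF e(2) d(1) m(2)] d(2) eq by simp
  then have "m \<cdot> d = h"
    by (rule regular_epi_cancel[OF e Comp_hom[OF d(1) m(2)] h])
  then show ?thesis using d(1) by blast
qed

end

section \<open>Finite shapes for binary products and pullbacks\<close>

text \<open>Objects double as their own identities. Each arrow composes only with itself, so
  returning one argument of \<open>Comp\<close> is already the composite.\<close>

definition discrete_pair :: "(nat, nat) cat" where
  "discrete_pair = \<lparr>Ob = {0, 1}, Ar = {0, 1}, Dom = id, Cod = id, Id = id, Comp = (\<lambda>g f. f)\<rparr>"

text \<open>Arrows \<open>0, 1, 2\<close> are the identities, and \<open>3 : 0 \<rightarrow> 2\<close>, \<open>4 : 1 \<rightarrow> 2\<close>.\<close>

definition cospan :: "(nat, nat) cat" where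
  "cospan = \<lparr>Ob = {0, 1, 2}, Ar = {0, 1, 2, 3, 4},
     Dom = (\<lambda>u. if u = 3 then 0 else if u = 4 then 1 else u),
     Cod = (\<lambda>u. if u = 3 \<or> u = 4 then 2 else u),
     Id = id, Comp = (\<lambda>g f. if f \<in> {3, 4} then f else g)\<rparr>"

lemma category_discrete_pair: "category discrete_pair"
  by unfold_locales (simp_all add: discrete_pair_def hom_def)

lemma category_cospan: "category cospan"
proof
  fix X Y Z f g assume fg: "f \<in> hom cospan X Y" "g \<in> hom cospan Y Z"
  show "g \<cdot>\<^bsub>cospan\<^esub> f \<in> hom cospan X Z"
  \<comment> \<open>A nonidentity first arrow ends at the corner \<open>2\<close>, where only the
    identity starts, so \<open>f\<close> itself is the composite. Otherwise \<open>f\<close> is an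
    identity and the composite is \<open>g\<close>.\<close>
  proof (cases "f \<in> {3, 4}")
    case True
    then have "Y = 2" using fg by (auto simp: cospan_def hom_def)
    then have "Z = 2" using fg by (auto simp: cospan_def hom_def split: if_splits)
    then show ?thesis using True fg \<open>Y = 2\<close> by (simp add: cospan_def hom_def)
  next
    case False
    then have "X = Y" using fg by (auto simp: cospan_def hom_def)
    then show ?thesis using False fg by (simp add: cospan_def hom_def)
  qed
next
  show "(h \<cdot>\<^bsub>cospan\<^esub> g) \<cdot>\<^bsub>cospan\<^esub> f = h \<cdot>\<^bsub>cospan\<^esub> (g \<cdot>\<^bsub>cospan\<^esub> f)" for f g h
    by (simp add: cospan_def)
  show "Dom cospan f \<in> Ob cospan" "Cod cospan f \<in> Ob cospan" if "f \<in> Ar cospan" for f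
    using that by (auto simp: cospan_def)
  show "Id cospan X \<in> hom cospan X X" if "X \<in> Ob cospan" for X
    using that by (auto simp: cospan_def hom_def)
  have obj: "X \<notin> {3, 4}" "Y \<notin> {3, 4}" if "f \<in> hom cospan X Y" for f X Y
    using that by (auto simp: cospan_def hom_def split: if_splits)
  show "f \<cdot>\<^bsub>cospan\<^esub> Id cospan X = f" if "f \<in> hom cospan X Y" for f X Y
    using obj[OF that] by (simp add: cospan_def)
  show "Id cospan Y \<cdot>\<^bsub>cospan\<^esub> f = f" if "f \<in> hom cospan X Y" for f X Y
    using that by (auto simp: cospan_def hom_def)
qed

locale finitely_complete_category = category +
  assumes complete: "finitely_complete C"
begin

lemma ex_product:
  assumes "A \<in> Ob C" "B \<in> Ob C"
  shows "\<exists>p q. is_product C A B p q"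
proof -
  let ?FO = "\<lambda>i. if i = (0::nat) then A else B"
  let ?FA = "\<lambda>i. Id C (?FO i)"
  have "Id C X \<cdot> Id C X = Id C X" if "X \<in> Ob C" for X
    using Comp_Id[OF Id_hom[OF that]] .
  then have "is_functor discrete_pair C ?FO ?FA"
    using assms Id_hom by (auto simp: is_functor_def discrete_pair_def)
  moreover have "finite (Ob discrete_pair)" "finite (Ar discrete_pair)"
    by (auto simp: discrete_pair_def)
  ultimately obtain L p where "is_limit discrete_pair C ?FO ?FA L p"
    using complete category_discrete_pair unfolding finitely_complete_def by blast
  then have L: "p 0 \<in> hom C L A" "p 1 \<in> hom C L B"
    and u: "\<And>X x. is_cone discrete_pair C ?FO ?FA X x \<Longrightarrow>
      \<exists>!u. u \<in> hom C X L \<and> p 0 \<cdot> u = x 0 \<and> p 1 \<cdot> u = x 1"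
    by (auto simp: is_limit_def is_cone_def discrete_pair_def)
  have "\<exists>!u. u \<in> hom C X L \<and> p 0 \<cdot> u = f \<and> p 1 \<cdot> u = g"
    if fg: "f \<in> hom C X A" "g \<in> hom C X B" for X f g
  proof -
    have "is_cone discrete_pair C ?FO ?FA X (\<lambda>i. if i = 0 then f else g)"
      using fg hom_Ob[OF fg(1)] Id_Comp[OF fg(1)] Id_Comp[OF fg(2)]
      by (auto simp: is_cone_def discrete_pair_def)
    from u[OF this] show ?thesis by simp
  qed
  then have "is_product C A B (p 0) (p 1)"
    using L by (simp add: is_product_def hom_def)
  then show ?thesis by blast
qed

lemma ex_pullback:
  assumes f: "f \<in> hom C X Z" and g: "g \<in> hom C Y Z"
  shows "\<exists>p q. is_pullback C f g p q"
proof -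
  let ?FO = "\<lambda>i. if i = (0::nat) then X else if i = 1 then Y else Z"
  let ?FA = "\<lambda>i. if i = (3::nat) then f else if i = 4 then g else Id C (?FO i)"
  note Ob = hom_Ob[OF f] hom_Ob[OF g]
  note Ids = Comp_Id[OF Id_hom] Comp_Id[OF f] Id_Comp[OF f] Comp_Id[OF g] Id_Comp[OF g]
  have "is_functor cospan C ?FO ?FA"
    using Ob f g Ids Id_hom by (auto simp: is_functor_def cospan_def)
  moreover have "finite (Ob cospan)" "finite (Ar cospan)"
    by (auto simp: cospan_def)
  ultimately obtain L p where L: "is_limit cospan C ?FO ?FA L p"
    using complete category_cospan unfolding finitely_complete_def by blast
  then have p: "p 0 \<in> hom C L X" "p 1 \<in> hom C L Y" "f \<cdot> p 0 = p 2" "g \<cdot> p 1 = p 2"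
    by (auto simp: is_limit_def is_cone_def cospan_def)
  have "\<exists>!u. u \<in> hom C W L \<and> p 0 \<cdot> u = x \<and> p 1 \<cdot> u = y"
    if xy: "x \<in> hom C W X" "y \<in> hom C W Y" and eq: "f \<cdot> x = g \<cdot> y" for W x y
  proof -
    \<comment> \<open>The leg at the corner is forced to be the common composite of \<open>x\<close>
      with \<open>f\<close> and \<open>y\<close> with \<open>g\<close>.\<close>
    let ?x = "\<lambda>i. if i = 0 then x else if i = 1 then y else f \<cdot> x"
    have fx: "f \<cdot> x \<in> hom C W Z" by (rule Comp_hom[OF xy(1) f])
    have "is_cone cospan C ?FO ?FA W ?x"
      using xy fx eq hom_Ob[OF fx] Id_Comp[OF fx] Id_Comp[OF xy(1)] Id_Comp[OF xy(2)]
      by (auto simp: is_cone_def cospan_def)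
    then have "\<exists>!u. u \<in> hom C W L \<and> (\<forall>i\<in>Ob cospan. p i \<cdot> u = ?x i)"
      using L unfolding is_limit_def by blast
    \<comment> \<open>The condition at the corner follows from the one at \<open>0\<close>, because
      \<open>p 2 = f \<cdot> p 0\<close>. Only the two projections of a pullback remain to be
      tested.\<close>
    moreover have "u \<in> hom C W L \<and> (\<forall>i\<in>Ob cospan. p i \<cdot> u = ?x i) \<longleftrightarrow>
        u \<in> hom C W L \<and> p 0 \<cdot> u = x \<and> p 1 \<cdot> u = y" for u
      using Comp_assoc[OF _ p(1) f, of u W] p(3) by (auto simp: cospan_def)
    ultimately show ?thesis by simp
  qed
  then have "is_pullback C f g (p 0) (p 1)"
    using p f g by (simp add: is_pullback_def hom_def)
  then show ?thesis by blast
qed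

section \<open>Chosen products and pullbacks\<close>

lemma product_pr:
  assumes "A \<in> Ob C" "B \<in> Ob C"
  shows "is_product C A B (pr1 C A B) (pr2 C A B)"
proof -
  have "\<exists>pq. is_product C A B (fst pq) (snd pq)"
    using ex_product[OF assms] by simp
  from someI_ex[OF this] show ?thesis unfolding pr1_def pr2_def .
qed

lemma pullback_pb:
  assumes "f \<in> hom C X Z" "g \<in> hom C Y Z"
  shows "is_pullback C f g (pb1 C f g) (pb2 C f g)"
proof -
  have "\<exists>pq. is_pullback C f g (fst pq) (snd pq)"
    using ex_pullback[OF assms] by simp
  from someI_ex[OF this] show ?thesis unfolding pb1_def pb2_def .
qed

lemma pb_hom:
  assumes "f \<in> hom C X Z" "g \<in> hom C Y Z"
  shows "pb1 C f g \<in> hom C (Dom C (pb1 C f g)) X" "pb2 C f g \<in> hom C (Dom C (pb1 C f g)) Y"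
    "f \<cdot> pb1 C f g = g \<cdot> pb2 C f g"
  using pullback_pb[OF assms] assms by (auto simp: is_pullback_def hom_def)

lemma pullback_lift:
  assumes "is_pullback C f g p q" "x \<in> hom C X (Dom C f)" "y \<in> hom C X (Dom C g)" "f \<cdot> x = g \<cdot> y"
  obtains u where "u \<in> hom C X (Dom C p)" "p \<cdot> u = x" "q \<cdot> u = y"
proof -
  have "\<exists>!u. u \<in> hom C X (Dom C p) \<and> p \<cdot> u = x \<and> q \<cdot> u = y"
    using assms unfolding is_pullback_def by blast
  then show thesis using that by blast
qed

lemma pb_lift:
  assumes "f \<in> hom C X Z" "g \<in> hom C Y Z" "x \<in> hom C W X" "y \<in> hom C W Y" "f \<cdot> x = g \<cdot> y"
  obtains u where "u \<in> hom C W (Dom C (pb1 C f g))" "pb1 C f g \<cdot> u = x" "pb2 C f g \<cdot> u = y"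
  using pullback_lift[OF pullback_pb[OF assms(1,2)], of x W y, OF _ _ assms(5) that]
    assms(3,4) homD(2)[OF assms(1)] homD(2)[OF assms(2)] by simp

lemma pr_hom:
  assumes "A \<in> Ob C" "B \<in> Ob C"
  shows "pr1 C A B \<in> hom C (prod_ob C A B) A" "pr2 C A B \<in> hom C (prod_ob C A B) B"
  using product_pr[OF assms] by (auto simp: is_product_def prod_ob_def hom_def)

lemma pairing_unique:
  assumes "f \<in> hom C X A" "g \<in> hom C X B"
  shows "\<exists>!u. u \<in> hom C X (prod_ob C A B) \<and> pr1 C A B \<cdot> u = f \<and> pr2 C A B \<cdot> u = g"
  using product_pr[OF hom_Ob(2)[OF assms(1)] hom_Ob(2)[OF assms(2)]] assms
  unfolding is_product_def prod_ob_def by blast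

lemma pairing:
  assumes "f \<in> hom C X A" "g \<in> hom C X B"
  shows "pairing C f g \<in> hom C X (prod_ob C A B)"
    "pr1 C A B \<cdot> pairing C f g = f" "pr2 C A B \<cdot> pairing C f g = g"
  using theI'[OF pairing_unique[OF assms]] homD[OF assms(1)] homD[OF assms(2)]
  by (auto simp: pairing_def)

lemma prod_ext:
  assumes "u \<in> hom C X (prod_ob C A B)" "v \<in> hom C X (prod_ob C A B)" "A \<in> Ob C" "B \<in> Ob C"
    and "pr1 C A B \<cdot> u = pr1 C A B \<cdot> v" "pr2 C A B \<cdot> u = pr2 C A B \<cdot> v"
  shows "u = v"
  using pairing_unique[OF Comp_hom[OF assms(2) pr_hom(1)[OF assms(3,4)]]
      Comp_hom[OF assms(2) pr_hom(2)[OF assms(3,4)]]] assms by metis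


end

section \<open>Generalized elements of relations\<close>

text \<open>A relation without monicity. Relatedness of elements makes sense at this level, so
  diagonals, opposites and intersections can be computed elementwise before they are known to be
  monic.\<close>

definition endospan :: "('o, 'a) cat \<Rightarrow> 'o \<Rightarrow> 'a \<Rightarrow> bool" where
  "endospan C A r \<longleftrightarrow> A \<in> Ob C \<and> r \<in> Ar C \<and> Cod C r = prod_ob C A A"

text \<open>Stated through the legs instead of \<open>pairing\<close>, and with the stage
  \<open>X\<close> hidden: for an \<open>endospan\<close>, the witness \<open>h\<close> forces
  \<open>x\<close> and \<open>y\<close> to be parallel arrows into \<open>A\<close>.\<close>

definition related :: "('o, 'a) cat \<Rightarrow> 'o \<Rightarrow> 'a \<Rightarrow> 'a \<Rightarrow> 'a \<Rightarrow> bool" where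
  "related C A r x y \<longleftrightarrow>
     (\<exists>X. \<exists>h\<in>hom C X (Dom C r). leg1 C A r \<cdot>\<^bsub>C\<^esub> h = x \<and> leg2 C A r \<cdot>\<^bsub>C\<^esub> h = y)"

text \<open>Replaces the component \<open>fb\<close> of a morphism of preorders by a property of
  \<open>f\<close>; for preorders, such an \<open>fb\<close> exists exactly when this holds.\<close>

definition monotone_ar :: "('o, 'a) cat \<Rightarrow> 'o \<Rightarrow> 'a \<Rightarrow> 'a \<Rightarrow> 'o \<Rightarrow> 'a \<Rightarrow> bool" where
  "monotone_ar C A r f B s \<longleftrightarrow> f \<in> hom C A B \<and>
     (\<forall>x y. related C A r x y \<longrightarrow> related C B s (f \<cdot>\<^bsub>C\<^esub> x) (f \<cdot>\<^bsub>C\<^esub> y))"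

text \<open>A morphism into a preorder is determined by its first component, as the target relation
  is monic. The description operator recovers the second component, so that computations can refer
  to \<open>f\<close> alone.\<close>

definition preord_arrow :: "('o, 'a) cat \<Rightarrow> 'o \<Rightarrow> 'a \<Rightarrow> 'a \<Rightarrow> 'o \<Rightarrow> 'a \<Rightarrow> ('o, 'a) preord_ar" where
  "preord_arrow C A r f B s = ((A, r), (f, THE fb. preord_mor C (A, r) (f, fb) (B, s)), (B, s))"

lemma preord_arrow_simps [simp]:
  "Dom (PreOrd C) (preord_arrow C A r f B s) = (A, r)"
  "Cod (PreOrd C) (preord_arrow C A r f B s) = (B, s)"
  "preord_arrow C A r f B s = preord_arrow C A r g B s \<longleftrightarrow> f = g"
  by (auto simp: PreOrd_def preord_arrow_def)

context finitely_complete_category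
begin

lemma endospanD:
  assumes "endospan C A r"
  shows "A \<in> Ob C" "r \<in> hom C (Dom C r) (prod_ob C A A)"
  using assms by (auto simp: endospan_def hom_def)

lemma is_relation_endospan: "is_relation C A r \<Longrightarrow> endospan C A r"
  by (simp add: is_relation_def endospan_def monic_def)

lemma leg_hom:
  assumes "endospan C A r"
  shows "leg1 C A r \<in> hom C (Dom C r) A" "leg2 C A r \<in> hom C (Dom C r) A"
  using endospanD[OF assms] pr_hom Comp_hom unfolding leg1_def leg2_def by blast+

lemma leg_comp:
  assumes "endospan C A r" "h \<in> hom C X (Dom C r)"
  shows "leg1 C A r \<cdot> h = pr1 C A A \<cdot> (r \<cdot> h)" "leg2 C A r \<cdot> h = pr2 C A A \<cdot> (r \<cdot> h)"
  using endospanD[OF assms(1)] pr_hom Comp_assoc[OF assms(2)] unfolding leg1_def leg2_def by blast+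

lemma relatedI: "h \<in> hom C X (Dom C r) \<Longrightarrow> related C A r (leg1 C A r \<cdot> h) (leg2 C A r \<cdot> h)"
  by (auto simp: related_def)

text \<open>This is the generic related pair, witnessed by the identity of \<open>Dom C r\<close>.
  Any other related pair arises from it by precomposition.\<close>

lemma related_legs:
  assumes "endospan C A r"
  shows "related C A r (leg1 C A r) (leg2 C A r)"
  using relatedI[OF Id_hom[OF hom_Ob(1)[OF leg_hom(1)[OF assms]]], of A]
    Comp_Id[OF leg_hom(1)[OF assms]] Comp_Id[OF leg_hom(2)[OF assms]]
  by simp

lemma related_hom:
  assumes "endospan C A r" "related C A r x y"
  obtains X where "x \<in> hom C X A" "y \<in> hom C X A"
  using assms(2) leg_hom[OF assms(1)] Comp_hom unfolding related_def by blast

text \<open>An arrow has only one domain, so typing one of the two elements fixes the stage at which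
  the witness lives.\<close>

lemma relatedE:
  assumes "endospan C A r" "related C A r x y" "x \<in> hom C X A \<or> y \<in> hom C X A"
  obtains h where "h \<in> hom C X (Dom C r)" "leg1 C A r \<cdot> h = x" "leg2 C A r \<cdot> h = y"
proof -
  obtain X' h where h: "h \<in> hom C X' (Dom C r)" "leg1 C A r \<cdot> h = x" "leg2 C A r \<cdot> h = y"
    using assms(2) unfolding related_def by blast
  have "x \<in> hom C X' A" "y \<in> hom C X' A"
    using Comp_hom[OF h(1) leg_hom(1)[OF assms(1)]] Comp_hom[OF h(1) leg_hom(2)[OF assms(1)]] h
    by simp_all
  then have "X' = X" using assms(3) by (auto simp: hom_def)
  then show thesis using h that by blast
qed

text \<open>An arrow into the product is determined by its two projections. This passes between the
  leg form of relatedness and factorizations through \<open>r\<close>.\<close>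

lemma related_iff_factors:
  assumes "endospan C A r" "x \<in> hom C X A" "y \<in> hom C X A"
  shows "related C A r x y \<longleftrightarrow> (\<exists>h\<in>hom C X (Dom C r). r \<cdot> h = pairing C x y)"
proof
  note pr = pairing[OF assms(2,3)]
  note r = endospanD[OF assms(1)]
  { assume "related C A r x y"
    then obtain h where h: "h \<in> hom C X (Dom C r)" "leg1 C A r \<cdot> h = x" "leg2 C A r \<cdot> h = y"
      using relatedE[OF assms(1)] assms(2) by metis
    have "r \<cdot> h = pairing C x y"
      using h leg_comp[OF assms(1) h(1)] pr
      by (intro prod_ext[OF Comp_hom[OF h(1) r(2)] pr(1) r(1) r(1)]) simp_all
    then show "\<exists>h\<in>hom C X (Dom C r). r \<cdot> h = pairing C x y" using h(1) by blast }
  { assume "\<exists>h\<in>hom C X (Dom C r). r \<cdot> h = pairing C x y"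
    then obtain h where h: "h \<in> hom C X (Dom C r)" "r \<cdot> h = pairing C x y" by blast
    show "related C A r x y"
      using relatedI[OF h(1), of A] leg_comp[OF assms(1) h(1)] h(2) pr by simp }
qed

lemma legs_jointly_monic:
  assumes "is_relation C A r" "h \<in> hom C X (Dom C r)" "k \<in> hom C X (Dom C r)"
    and "leg1 C A r \<cdot> h = leg1 C A r \<cdot> k" "leg2 C A r \<cdot> h = leg2 C A r \<cdot> k"
  shows "h = k"
proof -
  note span = is_relation_endospan[OF assms(1)]
  note r = endospanD[OF span]
  have "r \<cdot> h = r \<cdot> k"
    using assms(4,5) leg_comp[OF span assms(2)] leg_comp[OF span assms(3)]
    by (intro prod_ext[OF Comp_hom[OF assms(2) r(2)] Comp_hom[OF assms(3) r(2)] r(1) r(1)]) simp_all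
  then show ?thesis
    using monic_cancel[OF _ r(2) assms(2,3)] assms(1) by (simp add: is_relation_def)
qed

text \<open>Relatedness is stable under change of stage: precompose the witness with
  \<open>c\<close>.\<close>

lemma related_comp:
  assumes "endospan C A r" "related C A r x y" "x \<in> hom C X A \<or> y \<in> hom C X A" "c \<in> hom C Y X"
  shows "related C A r (x \<cdot> c) (y \<cdot> c)"
proof -
  obtain h where h: "h \<in> hom C X (Dom C r)" "leg1 C A r \<cdot> h = x" "leg2 C A r \<cdot> h = y"
    using relatedE[OF assms(1-3)] .
  show ?thesis
    using relatedI[OF Comp_hom[OF assms(4) h(1)], of A] h(2,3)
      Comp_assoc[OF assms(4) h(1) leg_hom(1)[OF assms(1)]]
      Comp_assoc[OF assms(4) h(1) leg_hom(2)[OF assms(1)]] by simp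
qed

section \<open>Inclusion, diagonal, opposite and intersection on elements\<close>

text \<open>A Yoneda argument: the test at the generic pair of \<open>m\<close> already yields the
  factorization through \<open>n\<close>, and every other test is a change of stage of this
  one.\<close>

lemma sub_le_iff_related:
  assumes "endospan C A m" "endospan C A n"
  shows "sub_le C m n \<longleftrightarrow> (\<forall>x y. related C A m x y \<longrightarrow> related C A n x y)"
proof
  note m = leg_hom[OF assms(1)]
  \<comment> \<open>As \<open>m\<close> is the pairing of its own legs, a factorization of
    \<open>m\<close> through \<open>n\<close> is the same as \<open>n\<close>-relatedness of those
    legs.\<close>
  have "pairing C (leg1 C A m) (leg2 C A m) = m"
    using prod_ext[OF pairing(1)[OF m] endospanD(2)[OF assms(1)] endospanD(1,1)[OF assms(1)]] pairing[OF m]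
    by (simp add: leg1_def leg2_def)
  then have le: "sub_le C m n \<longleftrightarrow> related C A n (leg1 C A m) (leg2 C A m)"
    using related_iff_factors[OF assms(2) m] by (simp add: sub_le_def)
  { assume "sub_le C m n"
    then have n: "related C A n (leg1 C A m) (leg2 C A m)" using le by simp
    show "\<forall>x y. related C A m x y \<longrightarrow> related C A n x y"
      using related_comp[OF assms(2) n] m(1) unfolding related_def[of C A m] by blast }
  { assume "\<forall>x y. related C A m x y \<longrightarrow> related C A n x y"
    then show "sub_le C m n" using le related_legs[OF assms(1)] by blast }
qed

lemma endospan_diag:
  assumes "A \<in> Ob C"
  shows "endospan C A (diag C A)"
  using pairing(1)[OF Id_hom Id_hom, OF assms assms] assms by (auto simp: endospan_def diag_def hom_def)

lemma related_diag:
  assumes "A \<in> Ob C"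
  shows "related C A (diag C A) x y \<longleftrightarrow> x = y \<and> (\<exists>X. x \<in> hom C X A)"
proof -
  note p = pairing[OF Id_hom Id_hom, OF assms assms]
  have "Dom C (diag C A) = A" "leg1 C A (diag C A) = Id C A" "leg2 C A (diag C A) = Id C A"
    using p by (auto simp: leg1_def leg2_def diag_def hom_def)
  then show ?thesis using Id_Comp by (auto simp: related_def)
qed

text \<open>The first projection is a retraction of the diagonal, which is therefore monic.\<close>

lemma is_relation_diag:
  assumes "A \<in> Ob C"
  shows "is_relation C A (diag C A)"
proof -
  note p = pairing[OF Id_hom Id_hom, OF assms assms, folded diag_def]
  have "f = g" if "f \<in> hom C X A" "g \<in> hom C X A" "diag C A \<cdot> f = diag C A \<cdot> g" for X f g
    using that Id_Comp[OF that(1)] Id_Comp[OF that(2)] p(2)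
      Comp_assoc[OF that(1) p(1) pr_hom(1)[OF assms assms]]
      Comp_assoc[OF that(2) p(1) pr_hom(1)[OF assms assms]] by metis
  then show ?thesis
    using assms homD[OF p(1)] by (simp add: is_relation_def monic_def)
qed

lemma endospan_opp:
  assumes "endospan C A r"
  shows "endospan C A (opp C A r)"
  using pairing(1)[OF leg_hom(2,1)[OF assms]] assms by (auto simp: endospan_def opp_def hom_def)

lemma opp_simps:
  assumes "endospan C A r"
  shows "Dom C (opp C A r) = Dom C r"
    "leg1 C A (opp C A r) = leg2 C A r" "leg2 C A (opp C A r) = leg1 C A r"
proof -
  note p = pairing[OF leg_hom(2,1)[OF assms], folded opp_def]
  show "Dom C (opp C A r) = Dom C r" using homD[OF p(1)] by simp
  show "leg1 C A (opp C A r) = leg2 C A r" "leg2 C A (opp C A r) = leg1 C A r"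
    using p(2,3) by (simp_all add: leg1_def leg2_def)
qed

lemma related_opp: "endospan C A r \<Longrightarrow> related C A (opp C A r) x y \<longleftrightarrow> related C A r y x"
  by (auto simp: related_def opp_simps)

text \<open>The opposite has the same legs in the other order, so joint monicity of the legs of
  \<open>r\<close> carries over.\<close>

lemma is_relation_opp:
  assumes "is_relation C A r"
  shows "is_relation C A (opp C A r)"
proof -
  note span = is_relation_endospan[OF assms]
  note o = endospan_opp[OF span]
  have "f = g" if fg: "f \<in> hom C X (Dom C (opp C A r))" "g \<in> hom C X (Dom C (opp C A r))"
    and eq: "opp C A r \<cdot> f = opp C A r \<cdot> g" for X f g
    using legs_jointly_monic[OF assms, of f X g] fg eq leg_comp[OF o fg(1)] leg_comp[OF o fg(2)]
    by (simp add: opp_simps[OF span])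
  then show ?thesis
    using o by (simp add: is_relation_def endospan_def monic_def)
qed

lemma endospan_inter:
  assumes "endospan C A m" "endospan C A n"
  shows "endospan C A (sub_inter C m n)"
  using homD[OF Comp_hom[OF pb_hom(1)]] endospanD(2)[OF assms(1)] endospanD(2)[OF assms(2)]
    endospanD(1)[OF assms(1)]
  unfolding endospan_def sub_inter_def by metis

lemma related_inter:
  assumes "endospan C A m" "endospan C A n"
  shows "related C A (sub_inter C m n) x y \<longleftrightarrow> related C A m x y \<and> related C A n x y"
proof
  note m = endospanD(2)[OF assms(1)] and n = endospanD(2)[OF assms(2)]
  note pb = pb_hom[OF m n]
  have i: "endospan C A (sub_inter C m n)" by (rule endospan_inter[OF assms])
  have dom: "Dom C (sub_inter C m n) = Dom C (pb1 C m n)"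
    unfolding sub_inter_def by (rule homD(2)[OF Comp_hom[OF pb(1) m]])
  have 1: "sub_le C (sub_inter C m n) m"
    unfolding sub_le_def dom by (rule bexI[OF _ pb(1)]) (simp add: sub_inter_def)
  have 2: "sub_le C (sub_inter C m n) n"
    unfolding sub_le_def dom by (rule bexI[OF _ pb(2)]) (simp add: sub_inter_def pb(3))
  show "related C A m x y \<and> related C A n x y" if "related C A (sub_inter C m n) x y"
    using that 1 2 sub_le_iff_related[OF i assms(1)] sub_le_iff_related[OF i assms(2)] by blast
  assume mn: "related C A m x y \<and> related C A n x y"
  then obtain X where xy: "x \<in> hom C X A" "y \<in> hom C X A"
    using related_hom[OF assms(1)] by blast
  obtain h k where h: "h \<in> hom C X (Dom C m)" "m \<cdot> h = pairing C x y"
    and k: "k \<in> hom C X (Dom C n)" "n \<cdot> k = pairing C x y"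
    using mn related_iff_factors[OF assms(1) xy] related_iff_factors[OF assms(2) xy] by blast
  \<comment> \<open>\<open>m \<cdot> h\<close> and \<open>n \<cdot> k\<close> are both
    \<open>pairing C x y\<close>, so \<open>h\<close> and \<open>k\<close> combine into an arrow to
    the pullback.\<close>
  obtain u where u: "u \<in> hom C X (Dom C (pb1 C m n))" "pb1 C m n \<cdot> u = h"
    using pb_lift[OF m n h(1) k(1)] h(2) k(2) by auto
  have "sub_inter C m n \<cdot> u = pairing C x y"
    using Comp_assoc[OF u(1) pb(1) m] u(2) h(2) by (simp add: sub_inter_def)
  then show "related C A (sub_inter C m n) x y"
    using related_iff_factors[OF i xy] u(1) dom by auto
qed

text \<open>Equality after \<open>sub_inter C m n\<close> gives equality after both pullback
  projections, by cancelling \<open>m\<close> and \<open>n\<close> in turn. Uniqueness of arrows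
  into the pullback then applies.\<close>

lemma is_relation_inter:
  assumes "is_relation C A m" "is_relation C A n"
  shows "is_relation C A (sub_inter C m n)"
proof -
  note spans = assms[THEN is_relation_endospan]
  note m = endospanD(2)[OF spans(1)] and n = endospanD(2)[OF spans(2)]
  note pb = pb_hom[OF m n]
  have monic: "monic C m" "monic C n" using assms by (simp_all add: is_relation_def)
  have i: "endospan C A (sub_inter C m n)" by (rule endospan_inter[OF spans])
  have "u = v" if u: "u \<in> hom C X (Dom C (pb1 C m n))" and v: "v \<in> hom C X (Dom C (pb1 C m n))"
    and eq: "sub_inter C m n \<cdot> u = sub_inter C m n \<cdot> v" for X u v
  proof -
    note hs = Comp_hom[OF u pb(1)] Comp_hom[OF v pb(1)] Comp_hom[OF u pb(2)] Comp_hom[OF v pb(2)]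
    have "m \<cdot> (pb1 C m n \<cdot> u) = m \<cdot> (pb1 C m n \<cdot> v)"
      using eq Comp_assoc[OF u pb(1) m] Comp_assoc[OF v pb(1) m] by (simp add: sub_inter_def)
    then have 1: "pb1 C m n \<cdot> u = pb1 C m n \<cdot> v"
      by (rule monic_cancel[OF monic(1) m hs(1,2)])
    have "n \<cdot> (pb2 C m n \<cdot> u) = n \<cdot> (pb2 C m n \<cdot> v)"
      using eq Comp_assoc[OF u pb(2) n] Comp_assoc[OF v pb(2) n] by (simp add: sub_inter_def pb(3))
    then have 2: "pb2 C m n \<cdot> u = pb2 C m n \<cdot> v"
      by (rule monic_cancel[OF monic(2) n hs(3,4)])
    have eq: "m \<cdot> (pb1 C m n \<cdot> u) = n \<cdot> (pb2 C m n \<cdot> u)"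
      using Comp_assoc[OF u pb(1) m] Comp_assoc[OF u pb(2) n] pb(3) by simp
    have "\<exists>!w. w \<in> hom C X (Dom C (pb1 C m n)) \<and> pb1 C m n \<cdot> w = pb1 C m n \<cdot> u \<and>
        pb2 C m n \<cdot> w = pb2 C m n \<cdot> u"
      using pullback_pb[OF m n] hs(1,3) eq unfolding is_pullback_def by blast
    then show ?thesis using u v 1 2 by auto
  qed
  moreover have "Dom C (sub_inter C m n) = Dom C (pb1 C m n)"
    unfolding sub_inter_def by (rule homD(2)[OF Comp_hom[OF pb(1) m]])
  ultimately show ?thesis
    using i by (simp add: is_relation_def endospan_def monic_def)
qed

section \<open>Order axioms on elements\<close>

lemma transitive_rel_iff:
  assumes "endospan C A r"
  shows "transitive_rel C A r \<longleftrightarrow>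
    (\<forall>x y z. related C A r x y \<longrightarrow> related C A r y z \<longrightarrow> related C A r x z)"
proof
  let ?r1 = "leg1 C A r" and ?r2 = "leg2 C A r"
  let ?p1 = "pb1 C ?r2 ?r1" and ?p2 = "pb2 C ?r2 ?r1"
  note r = leg_hom[OF assms]
  note p = pb_hom[OF r(2,1)]
  show "\<forall>x y z. related C A r x y \<longrightarrow> related C A r y z \<longrightarrow> related C A r x z"
    if "transitive_rel C A r"
  proof (intro allI impI)
    fix x y z assume xy: "related C A r x y" and yz: "related C A r y z"
    obtain t where t: "t \<in> hom C (Dom C ?p1) (Dom C r)" "?r1 \<cdot> t = ?r1 \<cdot> ?p1" "?r2 \<cdot> t = ?r2 \<cdot> ?p2"
      using \<open>transitive_rel C A r\<close> by (auto simp: transitive_rel_def Let_def)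
    obtain X where X: "x \<in> hom C X A" "y \<in> hom C X A" using related_hom[OF assms xy] .
    obtain h where h: "h \<in> hom C X (Dom C r)" "?r1 \<cdot> h = x" "?r2 \<cdot> h = y"
      using relatedE[OF assms xy] X by blast
    obtain k where k: "k \<in> hom C X (Dom C r)" "?r1 \<cdot> k = y" "?r2 \<cdot> k = z"
      using relatedE[OF assms yz] X by blast
    obtain u where u: "u \<in> hom C X (Dom C ?p1)" "?p1 \<cdot> u = h" "?p2 \<cdot> u = k"
      using pb_lift[OF r(2,1) h(1) k(1)] h(3) k(2) by auto
    have "?r1 \<cdot> (t \<cdot> u) = x"
      using Comp_assoc[OF u(1) t(1) r(1)] Comp_assoc[OF u(1) p(1) r(1)] t(2) u(2) h(2) by simp
    moreover have "?r2 \<cdot> (t \<cdot> u) = z"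
      using Comp_assoc[OF u(1) t(1) r(2)] Comp_assoc[OF u(1) p(2) r(2)] t(3) u(3) k(3) by simp
    ultimately show "related C A r x z" using relatedI[OF Comp_hom[OF u(1) t(1)], of A] by simp
  qed
  assume trans: "\<forall>x y z. related C A r x y \<longrightarrow> related C A r y z \<longrightarrow> related C A r x z"
  \<comment> \<open>The pullback projections form the generic composable pair of related pairs;
    elementwise transitivity applied to it produces the arrow \<open>t\<close>.\<close>
  have "related C A r (?r1 \<cdot> ?p1) (?r2 \<cdot> ?p1)" "related C A r (?r2 \<cdot> ?p1) (?r2 \<cdot> ?p2)"
    using relatedI[OF p(1), of A] relatedI[OF p(2), of A] p(3) by simp_all
  then have "related C A r (?r1 \<cdot> ?p1) (?r2 \<cdot> ?p2)" using trans by blast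
  then show "transitive_rel C A r"
    using relatedE[OF assms] Comp_hom[OF p(1) r(1)] unfolding transitive_rel_def Let_def by metis
qed

lemma internal_preorder_iff:
  "internal_preorder C A r \<longleftrightarrow> is_relation C A r \<and>
    (\<forall>X. \<forall>x\<in>hom C X A. related C A r x x) \<and>
    (\<forall>x y z. related C A r x y \<longrightarrow> related C A r y z \<longrightarrow> related C A r x z)"
proof (cases "is_relation C A r")
  case True
  note span = is_relation_endospan[OF True]
  note A = endospanD(1)[OF span]
  have "reflexive_rel C A r \<longleftrightarrow> (\<forall>X. \<forall>x\<in>hom C X A. related C A r x x)"
    using sub_le_iff_related[OF endospan_diag[OF A] span] related_diag[OF A]
    by (auto simp: reflexive_rel_def)
  then show ?thesis
    using True transitive_rel_iff[OF span] by (simp add: internal_preorder_def)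
qed (simp add: internal_preorder_def)

lemma internal_preorderD:
  assumes "internal_preorder C A r"
  shows "is_relation C A r" "endospan C A r" "A \<in> Ob C"
    "x \<in> hom C X A \<Longrightarrow> related C A r x x"
    "related C A r x y \<Longrightarrow> related C A r y z \<Longrightarrow> related C A r x z"
  using assms is_relation_endospan endospanD(1) unfolding internal_preorder_iff by blast+

lemma internal_equivalence_iff:
  "internal_equivalence C A r \<longleftrightarrow> internal_preorder C A r \<and>
    (\<forall>x y. related C A r x y \<longrightarrow> related C A r y x)"
proof (cases "internal_preorder C A r")
  case True
  note span = internal_preorderD(2)[OF True]
  note o = endospan_opp[OF span]
  show ?thesis
    using True sub_le_iff_related[OF span o] sub_le_iff_related[OF o span]
    by (auto simp: internal_equivalence_def sub_eq_def related_opp[OF span])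
qed (simp add: internal_equivalence_def)

text \<open>Reflexivity already puts the diagonal below \<open>r\<close> and its opposite. The
  reverse inclusion, read on elements, is antisymmetry.\<close>

lemma internal_partial_order_iff:
  "internal_partial_order C A r \<longleftrightarrow> internal_preorder C A r \<and>
    (\<forall>x y. related C A r x y \<longrightarrow> related C A r y x \<longrightarrow> x = y)"
proof (cases "internal_preorder C A r")
  case True
  note span = internal_preorderD(2)[OF True] and A = internal_preorderD(3)[OF True]
  note o = endospan_opp[OF span]
  note i = endospan_inter[OF span o] and d = endospan_diag[OF A]
  have "sub_eq C (sub_inter C r (opp C A r)) (diag C A) \<longleftrightarrow>
      (\<forall>x y. related C A r x y \<longrightarrow> related C A r y x \<longrightarrow> x = y)"
    using sub_le_iff_related[OF i d] sub_le_iff_related[OF d i] internal_preorderD(4)[OF True]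
      related_hom[OF span]
    unfolding sub_eq_def related_inter[OF span o] related_opp[OF span] related_diag[OF A] by metis
  then show ?thesis using True by (simp add: internal_partial_order_def)
qed (simp add: internal_partial_order_def)


section \<open>Morphisms of preorders and monotone arrows\<close>

text \<open>Monotonicity at the generic pair of \<open>r\<close> gives a witness in
  \<open>s\<close>, and this witness is the required second component.\<close>

lemma monotone_lift:
  assumes r: "endospan C A r" and s: "endospan C B s" and f: "f \<in> hom C A B"
    and mono: "\<And>x y. related C A r x y \<Longrightarrow> related C B s (f \<cdot> x) (f \<cdot> y)"
  shows "\<exists>fb. preord_mor C (A, r) (f, fb) (B, s)"
proof -
  have "related C B s (f \<cdot> leg1 C A r) (f \<cdot> leg2 C A r)"
    by (rule mono[OF related_legs[OF r]])
  then obtain fb where "fb \<in> hom C (Dom C r) (Dom C s)"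
    "leg1 C B s \<cdot> fb = f \<cdot> leg1 C A r" "leg2 C B s \<cdot> fb = f \<cdot> leg2 C A r"
    using relatedE[OF s] Comp_hom[OF leg_hom(1)[OF r] f] by blast
  then show ?thesis using f by (auto simp: preord_mor_def)
qed

lemma preord_mor_related:
  assumes r: "endospan C A r" and s: "endospan C B s" and mor: "preord_mor C (A, r) (f, fb) (B, s)"
    and xy: "related C A r x y"
  shows "related C B s (f \<cdot> x) (f \<cdot> y)"
proof -
  have f: "f \<in> hom C A B" "fb \<in> hom C (Dom C r) (Dom C s)"
    "f \<cdot> leg1 C A r = leg1 C B s \<cdot> fb" "f \<cdot> leg2 C A r = leg2 C B s \<cdot> fb"
    using mor by (simp_all add: preord_mor_def)
  obtain X h where h: "h \<in> hom C X (Dom C r)" "leg1 C A r \<cdot> h = x" "leg2 C A r \<cdot> h = y"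
    using xy by (auto simp: related_def)
  show ?thesis
    using relatedI[OF Comp_hom[OF h(1) f(2)], of B] f(3,4) h(2,3)
      Comp_assoc[OF h(1) leg_hom(1)[OF r] f(1)] Comp_assoc[OF h(1) leg_hom(2)[OF r] f(1)]
      Comp_assoc[OF h(1) f(2) leg_hom(1)[OF s]] Comp_assoc[OF h(1) f(2) leg_hom(2)[OF s]] by simp
qed

lemma preord_mor_unique:
  assumes "is_relation C B s" "preord_mor C (A, r) (f, fb) (B, s)" "preord_mor C (A, r) (f, fb') (B, s)"
  shows "fb = fb'"
  using assms(2,3) legs_jointly_monic[OF assms(1), of fb "Dom C r" fb'] by (simp add: preord_mor_def)

lemma preord_arrow_eq:
  assumes "internal_preorder C B s" "preord_mor C (A, r) (f, fb) (B, s)"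
  shows "preord_arrow C A r f B s = ((A, r), (f, fb), (B, s))"
  using the_equality[of "\<lambda>fb. preord_mor C (A, r) (f, fb) (B, s)", OF assms(2)]
    preord_mor_unique[OF internal_preorderD(1)[OF assms(1)] _ assms(2)]
  by (simp add: preord_arrow_def)

lemma preord_mor_monotone:
  assumes "internal_preorder C A r" "internal_preorder C B s" "preord_mor C (A, r) (f, fb) (B, s)"
  shows "monotone_ar C A r f B s"
  using preord_mor_related[OF internal_preorderD(2)[OF assms(1)] internal_preorderD(2)[OF assms(2)] assms(3)]
    assms(3)
  by (simp add: monotone_ar_def preord_mor_def)

lemma monotone_preord_mor:
  assumes "internal_preorder C A r" "internal_preorder C B s" "monotone_ar C A r f B s"
  obtains fb where "preord_mor C (A, r) (f, fb) (B, s)"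
    "preord_arrow C A r f B s = ((A, r), (f, fb), (B, s))"
proof -
  obtain fb where fb: "preord_mor C (A, r) (f, fb) (B, s)"
    using monotone_lift[OF internal_preorderD(2)[OF assms(1)] internal_preorderD(2)[OF assms(2)]]
      assms(3) unfolding monotone_ar_def by blast
  show thesis by (rule that[OF fb preord_arrow_eq[OF assms(2) fb]])
qed

section \<open>Preorders and monotone morphisms\<close>

text \<open>From here on hom-sets of preorders are handled as sets of monotone arrows, with the
  second component kept inside \<open>preord_arrow\<close>.\<close>

lemma PreOrd_hom_iff:
  "\<phi> \<in> hom (PreOrd C) (A, r) (B, s) \<longleftrightarrow> internal_preorder C A r \<and> internal_preorder C B s \<and>
    (\<exists>f. monotone_ar C A r f B s \<and> \<phi> = preord_arrow C A r f B s)"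
proof
  assume "\<phi> \<in> hom (PreOrd C) (A, r) (B, s)"
  then obtain f fb where "\<phi> = ((A, r), (f, fb), (B, s))" "internal_preorder C A r"
    "internal_preorder C B s" "preord_mor C (A, r) (f, fb) (B, s)"
    by (auto simp: hom_def PreOrd_def)
  then show "internal_preorder C A r \<and> internal_preorder C B s \<and>
      (\<exists>f. monotone_ar C A r f B s \<and> \<phi> = preord_arrow C A r f B s)"
    using preord_arrow_eq preord_mor_monotone by metis
next
  assume *: "internal_preorder C A r \<and> internal_preorder C B s \<and>
    (\<exists>f. monotone_ar C A r f B s \<and> \<phi> = preord_arrow C A r f B s)"
  then obtain f where f: "monotone_ar C A r f B s" "\<phi> = preord_arrow C A r f B s" by blast
  obtain fb where "preord_mor C (A, r) (f, fb) (B, s)" "\<phi> = ((A, r), (f, fb), (B, s))"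
    using monotone_preord_mor[of A r B s f] * f by metis
  then show "\<phi> \<in> hom (PreOrd C) (A, r) (B, s)"
    using * by (simp add: hom_def PreOrd_def)
qed

lemma preord_arrow_hom:
  assumes "internal_preorder C A r" "internal_preorder C B s" "monotone_ar C A r f B s"
  shows "preord_arrow C A r f B s \<in> hom (PreOrd C) (A, r) (B, s)"
  using assms PreOrd_hom_iff by blast

lemma monotone_ar_related:
  "monotone_ar C A r f B s \<Longrightarrow> related C A r x y \<Longrightarrow> related C B s (f \<cdot> x) (f \<cdot> y)"
  by (simp add: monotone_ar_def)

lemma monotone_ar_hom: "monotone_ar C A r f B s \<Longrightarrow> f \<in> hom C A B"
  by (simp add: monotone_ar_def)

lemma monotone_ar_Id:
  assumes "internal_preorder C A r"
  shows "monotone_ar C A r (Id C A) A r"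
proof -
  note r = internal_preorderD[OF assms]
  have "related C A r (Id C A \<cdot> x) (Id C A \<cdot> y)" if xy: "related C A r x y" for x y
  proof -
    obtain X where "x \<in> hom C X A" "y \<in> hom C X A" using related_hom[OF r(2) xy] .
    then show ?thesis using xy by (simp add: Id_Comp)
  qed
  then show ?thesis using Id_hom[OF r(3)] by (simp add: monotone_ar_def)
qed

lemma monotone_ar_Comp:
  assumes "internal_preorder C A r" "monotone_ar C A r f B s" "monotone_ar C B s g D t"
  shows "monotone_ar C A r (g \<cdot> f) D t"
proof -
  note f = monotone_ar_hom[OF assms(2)] and g = monotone_ar_hom[OF assms(3)]
  have "related C D t ((g \<cdot> f) \<cdot> x) ((g \<cdot> f) \<cdot> y)" if xy: "related C A r x y" for x y
  proof -
    obtain X where "x \<in> hom C X A" "y \<in> hom C X A"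
      using related_hom[OF internal_preorderD(2)[OF assms(1)] xy] .
    then show ?thesis
      using monotone_ar_related[OF assms(3) monotone_ar_related[OF assms(2) xy]] Comp_assoc[OF _ f g]
      by simp
  qed
  then show ?thesis using Comp_hom[OF f g] by (simp add: monotone_ar_def)
qed

section \<open>Category laws for internal preorders\<close>

lemma preord_arrow_Id:
  assumes "internal_preorder C A r"
  shows "Id (PreOrd C) (A, r) = preord_arrow C A r (Id C A) A r"
proof -
  note r = internal_preorderD[OF assms]
  note legs = leg_hom[OF r(2)]
  have "preord_mor C (A, r) (Id C A, Id C (Dom C r)) (A, r)"
    using Id_hom[OF r(3)] Id_hom[OF hom_Ob(1)[OF legs(1)]] Id_Comp[OF legs(1)] Id_Comp[OF legs(2)]
      Comp_Id[OF legs(1)] Comp_Id[OF legs(2)]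
    by (simp add: preord_mor_def)
  then show ?thesis using preord_arrow_eq[OF assms] by (simp add: PreOrd_def)
qed

lemma preord_arrow_Comp:
  assumes A: "internal_preorder C A r" and B: "internal_preorder C B s" and D: "internal_preorder C D t"
    and f: "monotone_ar C A r f B s" and g: "monotone_ar C B s g D t"
  shows "preord_arrow C B s g D t \<cdot>\<^bsub>PreOrd C\<^esub> preord_arrow C A r f B s = preord_arrow C A r (g \<cdot> f) D t"
proof -
  obtain fb where fb: "preord_mor C (A, r) (f, fb) (B, s)"
    "preord_arrow C A r f B s = ((A, r), (f, fb), (B, s))"
    using monotone_preord_mor[OF A B f] .
  obtain gb where gb: "preord_mor C (B, s) (g, gb) (D, t)"
    "preord_arrow C B s g D t = ((B, s), (g, gb), (D, t))"
    using monotone_preord_mor[OF B D g] .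
  note lA = leg_hom[OF internal_preorderD(2)[OF A]] and lB = leg_hom[OF internal_preorderD(2)[OF B]]
    and lD = leg_hom[OF internal_preorderD(2)[OF D]]
  have f': "f \<in> hom C A B" "fb \<in> hom C (Dom C r) (Dom C s)"
    and g': "g \<in> hom C B D" "gb \<in> hom C (Dom C s) (Dom C t)"
    using fb(1) gb(1) by (simp_all add: preord_mor_def)
  have "preord_mor C (A, r) (g \<cdot> f, gb \<cdot> fb) (D, t)"
    using fb(1) gb(1) Comp_hom[OF f'(1) g'(1)] Comp_hom[OF f'(2) g'(2)]
      Comp_assoc[OF lA(1) f'(1) g'(1)] Comp_assoc[OF lA(2) f'(1) g'(1)]
      Comp_assoc[OF f'(2) lB(1) g'(1)] Comp_assoc[OF f'(2) lB(2) g'(1)]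
      Comp_assoc[OF f'(2) g'(2) lD(1)] Comp_assoc[OF f'(2) g'(2) lD(2)]
    by (simp add: preord_mor_def)
  then have "preord_arrow C A r (g \<cdot> f) D t = ((A, r), (g \<cdot> f, gb \<cdot> fb), (D, t))"
    by (rule preord_arrow_eq[OF D])
  then show ?thesis by (simp add: fb(2) gb(2) PreOrd_def)
qed

lemma PreOrd_Ob: "(A, r) \<in> Ob (PreOrd C) \<longleftrightarrow> internal_preorder C A r"
  by (simp add: PreOrd_def)

lemma PreOrd_homE:
  assumes "\<phi> \<in> hom (PreOrd C) X Y"
  obtains A r B s f where "X = (A, r)" "Y = (B, s)" "internal_preorder C A r" "internal_preorder C B s"
    "monotone_ar C A r f B s" "\<phi> = preord_arrow C A r f B s"
  using assms PreOrd_hom_iff by (cases X, cases Y) blast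

text \<open>Identities and composites are computed on underlying arrows, which determine the
  morphisms. The laws are thus inherited from \<open>C\<close>.\<close>

lemma category_PreOrd: "category (PreOrd C)"
proof
  fix \<phi> assume "\<phi> \<in> Ar (PreOrd C)"
  then have "\<phi> \<in> hom (PreOrd C) (Dom (PreOrd C) \<phi>) (Cod (PreOrd C) \<phi>)" by (simp add: hom_def)
  then show "Dom (PreOrd C) \<phi> \<in> Ob (PreOrd C)" "Cod (PreOrd C) \<phi> \<in> Ob (PreOrd C)"
    by (auto elim!: PreOrd_homE simp: PreOrd_Ob)
next
  fix X assume "X \<in> Ob (PreOrd C)"
  then show "Id (PreOrd C) X \<in> hom (PreOrd C) X X"
    using preord_arrow_Id preord_arrow_hom monotone_ar_Id PreOrd_Ob by (cases X) metis
next
  fix X Y Z \<phi> \<psi> assume "\<phi> \<in> hom (PreOrd C) X Y" "\<psi> \<in> hom (PreOrd C) Y Z"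
  then show "\<psi> \<cdot>\<^bsub>PreOrd C\<^esub> \<phi> \<in> hom (PreOrd C) X Z"
    by (auto elim!: PreOrd_homE simp: preord_arrow_Comp intro!: preord_arrow_hom intro: monotone_ar_Comp)
next
  fix X Y \<phi> assume "\<phi> \<in> hom (PreOrd C) X Y"
  then show "\<phi> \<cdot>\<^bsub>PreOrd C\<^esub> Id (PreOrd C) X = \<phi>" "Id (PreOrd C) Y \<cdot>\<^bsub>PreOrd C\<^esub> \<phi> = \<phi>"
    by (auto elim!: PreOrd_homE
        simp: preord_arrow_Id preord_arrow_Comp monotone_ar_Id Comp_Id[OF monotone_ar_hom] Id_Comp[OF monotone_ar_hom])
next
  fix W X Y Z \<phi> \<psi> \<chi>
  assume "\<phi> \<in> hom (PreOrd C) W X" "\<psi> \<in> hom (PreOrd C) X Y" "\<chi> \<in> hom (PreOrd C) Y Z"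
  then show "(\<chi> \<cdot>\<^bsub>PreOrd C\<^esub> \<psi>) \<cdot>\<^bsub>PreOrd C\<^esub> \<phi> = \<chi> \<cdot>\<^bsub>PreOrd C\<^esub> (\<psi> \<cdot>\<^bsub>PreOrd C\<^esub> \<phi>)"
    by (auto elim!: PreOrd_homE simp: preord_arrow_Comp monotone_ar_Comp monotone_ar_hom
        Comp_assoc[OF monotone_ar_hom monotone_ar_hom monotone_ar_hom])
qed

section \<open>Repleteness and trivial morphisms\<close>

lemma PreOrd_isomorphicE:
  assumes "isomorphic (PreOrd C) X Y"
  obtains A r B s f g where "X = (A, r)" "Y = (B, s)"
    "monotone_ar C A r f B s" "monotone_ar C B s g A r" "f \<cdot> g = Id C B"
proof -
  obtain \<phi> \<psi> where \<phi>: "\<phi> \<in> hom (PreOrd C) X Y" and \<psi>: "\<psi> \<in> hom (PreOrd C) Y X"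
    and inv: "\<phi> \<cdot>\<^bsub>PreOrd C\<^esub> \<psi> = Id (PreOrd C) Y"
    using assms by (auto simp: isomorphic_def)
  obtain A r B s f where X: "X = (A, r)" "Y = (B, s)" and r: "internal_preorder C A r"
    and s: "internal_preorder C B s" and f: "monotone_ar C A r f B s" "\<phi> = preord_arrow C A r f B s"
    using PreOrd_homE[OF \<phi>] .
  obtain g where g: "monotone_ar C B s g A r" "\<psi> = preord_arrow C B s g A r"
    using \<psi> X PreOrd_hom_iff by blast
  have "f \<cdot> g = Id C B"
    using inv unfolding f(2) g(2) X preord_arrow_Comp[OF s r s g(1) f(1)] preord_arrow_Id[OF s] by simp
  then show thesis using that X f(1) g(1) by blast
qed

lemma retract_on_related:
  assumes "internal_preorder C B s" "f \<in> hom C A B" "g \<in> hom C B A" "f \<cdot> g = Id C B" "related C B s x y"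
  shows "f \<cdot> (g \<cdot> x) = x" "f \<cdot> (g \<cdot> y) = y"
proof -
  obtain X where x: "x \<in> hom C X B" and y: "y \<in> hom C X B"
    using related_hom[OF internal_preorderD(2)[OF assms(1)] assms(5)] .
  show "f \<cdot> (g \<cdot> x) = x" using Comp_assoc[OF x assms(3,2)] Id_Comp[OF x] assms(4) by simp
  show "f \<cdot> (g \<cdot> y) = y" using Comp_assoc[OF y assms(3,2)] Id_Comp[OF y] assms(4) by simp
qed

text \<open>Symmetry is transported: move a related pair to \<open>A\<close> along \<open>g\<close>,
  reverse it there, and return along \<open>f\<close>.\<close>

lemma replete_Eq_sub: "replete_sub (PreOrd C) (Eq_sub C)"
  unfolding replete_sub_def
proof (intro conjI ballI impI)
  show "Eq_sub C \<subseteq> Ob (PreOrd C)"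
    by (auto simp: Eq_sub_def PreOrd_def internal_equivalence_def)
next
  fix X Y assume X: "X \<in> Eq_sub C" and Y: "Y \<in> Ob (PreOrd C)" and iso: "isomorphic (PreOrd C) X Y"
  obtain A r B s f g where *: "X = (A, r)" "Y = (B, s)"
    and f: "monotone_ar C A r f B s" and g: "monotone_ar C B s g A r" and fg: "f \<cdot> g = Id C B"
    using PreOrd_isomorphicE[OF iso] .
  have s: "internal_preorder C B s" using Y * by (simp add: PreOrd_Ob)
  have "related C B s y x" if xy: "related C B s x y" for x y
  proof -
    have "related C A r (g \<cdot> y) (g \<cdot> x)"
      using X * monotone_ar_related[OF g xy] by (simp add: Eq_sub_def internal_equivalence_iff)
    from monotone_ar_related[OF f this] show ?thesis
      using retract_on_related[OF s monotone_ar_hom[OF f] monotone_ar_hom[OF g] fg xy] by simp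
  qed
  then show "Y \<in> Eq_sub C" using * s by (simp add: Eq_sub_def internal_equivalence_iff)
qed

text \<open>Antisymmetry in \<open>A\<close> identifies the images under \<open>g\<close>, and
  applying \<open>f\<close> recovers the original elements.\<close>

lemma replete_ParOrd_sub: "replete_sub (PreOrd C) (ParOrd_sub C)"
  unfolding replete_sub_def
proof (intro conjI ballI impI)
  show "ParOrd_sub C \<subseteq> Ob (PreOrd C)"
    by (auto simp: ParOrd_sub_def PreOrd_def internal_partial_order_def)
next
  fix X Y assume X: "X \<in> ParOrd_sub C" and Y: "Y \<in> Ob (PreOrd C)" and iso: "isomorphic (PreOrd C) X Y"
  obtain A r B s f g where *: "X = (A, r)" "Y = (B, s)"
    and f: "monotone_ar C A r f B s" and g: "monotone_ar C B s g A r" and fg: "f \<cdot> g = Id C B"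
    using PreOrd_isomorphicE[OF iso] .
  have s: "internal_preorder C B s" using Y * by (simp add: PreOrd_Ob)
  have "x = y" if xy: "related C B s x y" and yx: "related C B s y x" for x y
  proof -
    have "g \<cdot> x = g \<cdot> y"
      using X * monotone_ar_related[OF g xy] monotone_ar_related[OF g yx]
      by (simp add: ParOrd_sub_def internal_partial_order_iff)
    then show ?thesis
      using retract_on_related[OF s monotone_ar_hom[OF f] monotone_ar_hom[OF g] fg xy] by metis
  qed
  then show "Y \<in> ParOrd_sub C" using * s by (simp add: ParOrd_sub_def internal_partial_order_iff)
qed

text \<open>A morphism that identifies related elements factors through the discrete preorder on its codomain.\<close>

lemma trivial_ars_iff:
  assumes r: "internal_preorder C A r" and s: "internal_preorder C B s" and f: "monotone_ar C A r f B s"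
  shows "preord_arrow C A r f B s \<in> trivial_ars (PreOrd C) (Eq_sub C \<inter> ParOrd_sub C) \<longleftrightarrow>
    (\<forall>x y. related C A r x y \<longrightarrow> f \<cdot> x = f \<cdot> y)"
proof (intro iffI allI impI)
  fix x y assume "preord_arrow C A r f B s \<in> trivial_ars (PreOrd C) (Eq_sub C \<inter> ParOrd_sub C)"
    and xy: "related C A r x y"
  then obtain W w \<phi> \<psi> where W: "(W, w) \<in> Eq_sub C" "(W, w) \<in> ParOrd_sub C"
    and \<phi>: "\<phi> \<in> hom (PreOrd C) (A, r) (W, w)" and \<psi>: "\<psi> \<in> hom (PreOrd C) (W, w) (B, s)"
    and eq: "preord_arrow C A r f B s = \<psi> \<cdot>\<^bsub>PreOrd C\<^esub> \<phi>"
    by (auto simp: trivial_ars_def)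
  obtain h where h: "monotone_ar C A r h W w" "\<phi> = preord_arrow C A r h W w"
    and w: "internal_preorder C W w" using \<phi> PreOrd_hom_iff by blast
  obtain k where k: "monotone_ar C W w k B s" "\<psi> = preord_arrow C W w k B s"
    using \<psi> PreOrd_hom_iff by blast
  have f_eq: "f = k \<cdot> h"
    using eq unfolding h(2) k(2) preord_arrow_Comp[OF r w s h(1) k(1)] by simp
  have "related C W w (h \<cdot> x) (h \<cdot> y)" by (rule monotone_ar_related[OF h(1) xy])
  \<comment> \<open>In the middle object the relation is symmetric and antisymmetric, so related
    elements coincide.\<close>
  then have "h \<cdot> x = h \<cdot> y"
    using W by (simp add: Eq_sub_def ParOrd_sub_def internal_equivalence_iff internal_partial_order_iff)
  moreover obtain X where "x \<in> hom C X A" "y \<in> hom C X A"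
    using related_hom[OF internal_preorderD(2)[OF r] xy] .
  ultimately show "f \<cdot> x = f \<cdot> y"
    using f_eq Comp_assoc[OF _ monotone_ar_hom[OF h(1)] monotone_ar_hom[OF k(1)]] by simp
next
  assume eq: "\<forall>x y. related C A r x y \<longrightarrow> f \<cdot> x = f \<cdot> y"
  let ?d = "diag C B"
  note f' = monotone_ar_hom[OF f]
  note rD = internal_preorderD[OF r] and sD = internal_preorderD[OF s]
  note rel = related_diag[OF sD(3)]
  have fx: "\<exists>X. f \<cdot> x \<in> hom C X B" if xy: "related C A r x y" for x y
    using related_hom[OF rD(2) xy] Comp_hom[OF _ f'] by metis
  have d: "internal_preorder C B ?d"
    unfolding internal_preorder_iff rel using is_relation_diag[OF sD(3)] by blast
  have W: "(B, ?d) \<in> Eq_sub C \<inter> ParOrd_sub C"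
    using d by (auto simp: Eq_sub_def ParOrd_sub_def internal_equivalence_iff internal_partial_order_iff rel)
  \<comment> \<open>Monotonicity into the discrete preorder is exactly the hypothesis that
    \<open>f\<close> identifies related elements. The identity from the discrete preorder to
    \<open>s\<close> is monotone because \<open>s\<close> is reflexive.\<close>
  have h: "monotone_ar C A r f B ?d"
    using f' eq fx by (auto simp: monotone_ar_def rel)
  have k: "monotone_ar C B ?d (Id C B) B s"
    using Id_hom[OF sD(3)] sD(4) Comp_hom[OF _ Id_hom[OF sD(3)]] unfolding monotone_ar_def rel by blast
  have "preord_arrow C A r f B s = preord_arrow C B ?d (Id C B) B s \<cdot>\<^bsub>PreOrd C\<^esub> preord_arrow C A r f B ?d"
    using preord_arrow_Comp[OF r d s h k] Id_Comp[OF f'] by simp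
  then show "preord_arrow C A r f B s \<in> trivial_ars (PreOrd C) (Eq_sub C \<inter> ParOrd_sub C)"
    using W preord_arrow_hom[OF r d h] preord_arrow_hom[OF d s k] preord_arrow_hom[OF r s f]
    by (auto simp: trivial_ars_def hom_def[of "PreOrd C" "(A, r)" "(B, s)"])
qed

end

section \<open>The quotient partial order\<close>

locale barr_exact =
  fixes C :: "('o, 'a) cat" (structure)
  assumes exact: "exact_category C"

sublocale barr_exact \<subseteq> finitely_complete_category
  using exact by (simp add: exact_category_def finitely_complete_category_def finitely_complete_category_axioms_def)

context barr_exact
begin

section \<open>Descent and lifting along regular epimorphisms\<close>

text \<open>\<open>pairing C x y \<cdot> c\<close> factors through the mono \<open>r\<close>, and
  the diagonal fill-in against the regular epi \<open>c\<close> factors \<open>pairing C x y\<close>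
  itself. Hence relatedness may be checked on a cover.\<close>

lemma related_descend:
  assumes r: "is_relation C A r" and xy: "x \<in> hom C X A" "y \<in> hom C X A"
    and c: "regular_epi C c" "c \<in> hom C Y X" and rel: "related C A r (x \<cdot> c) (y \<cdot> c)"
  shows "related C A r x y"
proof -
  note span = is_relation_endospan[OF r]
  note p = pairing[OF xy]
  note xc = Comp_hom[OF c(2) xy(1)] and yc = Comp_hom[OF c(2) xy(2)]
  note A = endospanD(1)[OF span]
  obtain h where h: "h \<in> hom C Y (Dom C r)" "r \<cdot> h = pairing C (x \<cdot> c) (y \<cdot> c)"
    using rel related_iff_factors[OF span xc yc] by blast
  have "pairing C x y \<cdot> c = pairing C (x \<cdot> c) (y \<cdot> c)"
    using Comp_assoc[OF c(2) p(1) pr_hom(1)[OF A A]] Comp_assoc[OF c(2) p(1) pr_hom(2)[OF A A]]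
      p(2,3) pairing[OF xc yc]
    by (intro prod_ext[OF Comp_hom[OF c(2) p(1)] pairing(1)[OF xc yc] A A]) simp_all
  then have "pairing C x y \<cdot> c = r \<cdot> h" using h(2) by simp
  moreover have "monic C r" using r by (simp add: is_relation_def)
  ultimately have "\<exists>d\<in>hom C X (Dom C r). r \<cdot> d = pairing C x y"
    using regular_epi_strong[OF c _ endospanD(2)[OF span] p(1) h(1)] by blast
  then show ?thesis using related_iff_factors[OF span xy] by blast
qed

text \<open>Elements of \<open>B\<close> come from \<open>A\<close> locally: pull \<open>q\<close>
  back along \<open>b\<close>. Stability makes the projection to \<open>X\<close> a regular epi, and
  the other projection is the lift.\<close>

lemma regular_epi_lift:
  assumes q: "regular_epi C q" "q \<in> hom C A B" and b: "b \<in> hom C X B"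
  obtains Y c a where "regular_epi C c" "c \<in> hom C Y X" "a \<in> hom C Y A" "q \<cdot> a = b \<cdot> c"
proof -
  have "regular_epi C (pb2 C q b)"
    using exact q(1) pullback_pb[OF q(2) b] unfolding exact_category_def by blast
  then show thesis using that pb_hom[OF q(2) b] by blast
qed

lemma regular_image:
  assumes "f \<in> hom C X Y"
  obtains e I m where "regular_epi C e" "e \<in> hom C X I" "monic C m" "m \<in> hom C I Y" "f = m \<cdot> e"
proof -
  have "f \<in> Ar C" using homD[OF assms] by simp
  then obtain e m where em: "regular_epi C e" "monic C m" "Dom C m = Cod C e" "f = m \<cdot> e"
    using exact unfolding exact_category_def by blast
  note e = regular_epi_hom[OF em(1)]
  have m: "m \<in> hom C (Cod C e) (Cod C m)" using em(2,3) by (auto simp: monic_def hom_def)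
  have "Dom C e = X" "Cod C m = Y"
    using homD[OF Comp_hom[OF e m]] homD[OF assms] em(4) by simp_all
  then show thesis using that em e m by metis
qed

section \<open>The symmetric part and its quotient\<close>

lemma symmetric_part_equivalence:
  assumes "internal_preorder C A r"
  shows "internal_equivalence C A (sub_inter C r (opp C A r))"
proof -
  note r = internal_preorderD[OF assms]
  note rel = related_inter[OF r(2) endospan_opp[OF r(2)], unfolded related_opp[OF r(2)]]
  have "is_relation C A (sub_inter C r (opp C A r))"
    by (rule is_relation_inter[OF r(1) is_relation_opp[OF r(1)]])
  then show ?thesis
    unfolding internal_equivalence_iff internal_preorder_iff rel using r(4,5) by blast
qed

text \<open>By exactness the symmetric part is the kernel pair of some \<open>f\<close>. Factoring
  \<open>f = m \<cdot> q\<close> with \<open>m\<close> monic leaves the kernel pair unchanged, so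
  the regular epi \<open>q\<close> has the symmetric part as its kernel pair.\<close>

lemma symmetric_part_quotient:
  assumes "internal_preorder C A r"
  obtains B q where "regular_epi C q" "q \<in> hom C A B"
    "\<forall>X. \<forall>x\<in>hom C X A. \<forall>y\<in>hom C X A. q \<cdot> x = q \<cdot> y \<longleftrightarrow> related C A r x y \<and> related C A r y x"
proof -
  let ?E = "sub_inter C r (opp C A r)"
  note r = internal_preorderD[OF assms]
  have E: "internal_equivalence C A ?E" by (rule symmetric_part_equivalence[OF assms])
  have span: "endospan C A ?E" by (rule endospan_inter[OF r(2) endospan_opp[OF r(2)]])
  obtain f where f: "is_pullback C f f (leg1 C A ?E) (leg2 C A ?E)"
    using exact E unfolding exact_category_def by blast
  then have "f \<in> hom C A (Cod C f)"
    using leg_hom(1)[OF span] by (auto simp: is_pullback_def hom_def)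
  then obtain q B m where q: "regular_epi C q" "q \<in> hom C A B"
    and m: "monic C m" "m \<in> hom C B (Cod C f)" "f = m \<cdot> q"
    using regular_image by metis
  have "q \<cdot> x = q \<cdot> y \<longleftrightarrow> related C A r x y \<and> related C A r y x"
    if xy: "x \<in> hom C X A" "y \<in> hom C X A" for X x y
  proof -
    have "q \<cdot> x = q \<cdot> y \<longleftrightarrow> m \<cdot> (q \<cdot> x) = m \<cdot> (q \<cdot> y)"
      using monic_cancel[OF m(1,2) Comp_hom[OF xy(1) q(2)] Comp_hom[OF xy(2) q(2)]] by auto
    also have "\<dots> \<longleftrightarrow> f \<cdot> x = f \<cdot> y"
      using Comp_assoc[OF xy(1) q(2) m(2)] Comp_assoc[OF xy(2) q(2) m(2)] m(3) by simp
    also have "\<dots> \<longleftrightarrow> related C A ?E x y"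
    proof
      note legs = leg_hom[OF span]
      have dom: "Dom C f = A" "f \<in> hom C A (Cod C f)"
        using f homD[OF legs(1)] by (auto simp: is_pullback_def hom_def)
      show "related C A ?E x y" if eq: "f \<cdot> x = f \<cdot> y"
      proof -
        obtain u where "u \<in> hom C X (Dom C (leg1 C A ?E))" "leg1 C A ?E \<cdot> u = x" "leg2 C A ?E \<cdot> u = y"
          by (rule pullback_lift[OF f, unfolded dom(1), OF xy eq])
        then show ?thesis using relatedI[of u X ?E A] homD[OF legs(1)] by simp
      qed
      assume "related C A ?E x y"
      then obtain h where h: "h \<in> hom C X (Dom C ?E)" "leg1 C A ?E \<cdot> h = x" "leg2 C A ?E \<cdot> h = y"
        using relatedE[OF span] xy(1) by metis
      have "f \<cdot> leg1 C A ?E = f \<cdot> leg2 C A ?E" using f by (simp add: is_pullback_def)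
      then show "f \<cdot> x = f \<cdot> y"
        using Comp_assoc[OF h(1) legs(1) dom(2)] Comp_assoc[OF h(1) legs(2) dom(2)] h(2,3) by simp
    qed
    also have "\<dots> \<longleftrightarrow> related C A r x y \<and> related C A r y x"
      unfolding related_inter[OF r(2) endospan_opp[OF r(2)]] related_opp[OF r(2)] ..
    finally show ?thesis .
  qed
  then show thesis using that q by blast
qed

text \<open>\<open>q\<close> both preserves and reflects the order between \<open>r\<close> and its
  image \<open>s\<close>. The axioms for \<open>s\<close> are then read off from \<open>r\<close>
  after lifting elements of \<open>B\<close> to covers.\<close>

lemma quotient_partial_order:
  assumes "internal_preorder C A r"
  obtains B q s where "regular_epi C q" "q \<in> hom C A B"
    "\<forall>X. \<forall>x\<in>hom C X A. \<forall>y\<in>hom C X A. q \<cdot> x = q \<cdot> y \<longleftrightarrow> related C A r x y \<and> related C A r y x"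
    "internal_partial_order C B s"
    "\<forall>X. \<forall>x\<in>hom C X A. \<forall>y\<in>hom C X A. related C B s (q \<cdot> x) (q \<cdot> y) \<longleftrightarrow> related C A r x y"
proof -
  note r = internal_preorderD[OF assms]
  note legs = leg_hom[OF r(2)]
  obtain B q where q: "regular_epi C q" "q \<in> hom C A B"
    and ker: "\<And>X x y. x \<in> hom C X A \<Longrightarrow> y \<in> hom C X A \<Longrightarrow>
      q \<cdot> x = q \<cdot> y \<longleftrightarrow> related C A r x y \<and> related C A r y x"
    using symmetric_part_quotient[OF assms] by metis
  have B: "B \<in> Ob C" using hom_Ob[OF q(2)] by simp
  note ql = Comp_hom[OF legs(1) q(2)] Comp_hom[OF legs(2) q(2)]
  note p = pairing[OF ql]
  \<comment> \<open>\<open>s\<close> is the regular image of \<open>r\<close> under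
    \<open>q \<times> q\<close>; the composite being factored has the components
    \<open>q \<cdot> leg1 C A r\<close> and \<open>q \<cdot> leg2 C A r\<close>.\<close>
  obtain e I s where e: "regular_epi C e" "e \<in> hom C (Dom C r) I"
    and s: "monic C s" "s \<in> hom C I (prod_ob C B B)"
      "pairing C (q \<cdot> leg1 C A r) (q \<cdot> leg2 C A r) = s \<cdot> e"
    using regular_image[OF p(1)] by metis
  have rel: "is_relation C B s" using B s homD[OF s(2)] by (simp add: is_relation_def)
  note span = is_relation_endospan[OF rel]
  have I: "Dom C s = I" using homD[OF s(2)] by simp
  note slegs = leg_hom[OF span, unfolded I]
  have e_legs: "leg1 C B s \<cdot> e = q \<cdot> leg1 C A r" "leg2 C B s \<cdot> e = q \<cdot> leg2 C A r"
    using leg_comp[OF span, of e "Dom C r"] e(2) I p(2,3) s(3) by simp_all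
  have image: "related C B s (q \<cdot> x) (q \<cdot> y) \<longleftrightarrow> related C A r x y"
    if xy: "x \<in> hom C X A" "y \<in> hom C X A" for X x y
  proof
    assume "related C A r x y"
    then obtain h where h: "h \<in> hom C X (Dom C r)" "leg1 C A r \<cdot> h = x" "leg2 C A r \<cdot> h = y"
      using relatedE[OF r(2)] xy(1) by metis
    have "leg1 C B s \<cdot> (e \<cdot> h) = q \<cdot> x" "leg2 C B s \<cdot> (e \<cdot> h) = q \<cdot> y"
      using Comp_assoc[OF h(1) e(2) slegs(1)] Comp_assoc[OF h(1) e(2) slegs(2)] e_legs h(2,3)
        Comp_assoc[OF h(1) legs(1) q(2)] Comp_assoc[OF h(1) legs(2) q(2)] by simp_all
    then show "related C B s (q \<cdot> x) (q \<cdot> y)"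
      using relatedI[of "e \<cdot> h" X s B] Comp_hom[OF h(1) e(2)] I by simp
  next
    assume "related C B s (q \<cdot> x) (q \<cdot> y)"
    then obtain h where h: "h \<in> hom C X I" "leg1 C B s \<cdot> h = q \<cdot> x" "leg2 C B s \<cdot> h = q \<cdot> y"
      using relatedE[OF span] Comp_hom[OF xy(1) q(2)] I by metis
    \<comment> \<open>A witness in the image comes from \<open>r\<close> only on a cover, where
      \<open>h\<close> lifts through \<open>e\<close> to \<open>g\<close>.\<close>
    obtain Y c g where c: "regular_epi C c" "c \<in> hom C Y X" and g: "g \<in> hom C Y (Dom C r)" "e \<cdot> g = h \<cdot> c"
      using regular_epi_lift[OF e h(1)] .
    note xc = Comp_hom[OF c(2) xy(1)] Comp_hom[OF c(2) xy(2)]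
    note lg = Comp_hom[OF g(1) legs(1)] Comp_hom[OF g(1) legs(2)]
    have "q \<cdot> (leg1 C A r \<cdot> g) = q \<cdot> (x \<cdot> c)" "q \<cdot> (leg2 C A r \<cdot> g) = q \<cdot> (y \<cdot> c)"
      using Comp_assoc[OF g(1) legs(1) q(2)] Comp_assoc[OF g(1) legs(2) q(2)] e_legs
        Comp_assoc[OF g(1) e(2) slegs(1)] Comp_assoc[OF g(1) e(2) slegs(2)] g(2)
        Comp_assoc[OF c(2) h(1) slegs(1)] Comp_assoc[OF c(2) h(1) slegs(2)] h(2,3)
        Comp_assoc[OF c(2) xy(1) q(2)] Comp_assoc[OF c(2) xy(2) q(2)] by simp_all
    \<comment> \<open>Equal images under \<open>q\<close> mean related both ways in
      \<open>r\<close>. This gives a chain from \<open>x \<cdot> c\<close> through the two legs of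
      \<open>g\<close> to \<open>y \<cdot> c\<close>, which transitivity composes: \<open>r\<close>
      is saturated for its symmetric part.\<close>
    then have "related C A r (x \<cdot> c) (leg1 C A r \<cdot> g)" "related C A r (leg2 C A r \<cdot> g) (y \<cdot> c)"
      using ker[OF lg(1) xc(1)] ker[OF lg(2) xc(2)] by simp_all
    then have "related C A r (x \<cdot> c) (y \<cdot> c)"
      using r(5) relatedI[OF g(1), of A] by blast
    then show "related C A r x y" by (rule related_descend[OF r(1) xy c])
  qed
  have refl: "related C B s u u" if u: "u \<in> hom C X B" for X u
  proof -
    obtain Y c a where c: "regular_epi C c" "c \<in> hom C Y X" "a \<in> hom C Y A" "q \<cdot> a = u \<cdot> c"
      using regular_epi_lift[OF q u] .
    show ?thesis
      using image[OF c(3) c(3)] r(4)[OF c(3)] c(4) related_descend[OF rel u u c(1,2)] by simp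
  qed
  have trans: "related C B s u w" if uv: "related C B s u v" and vw: "related C B s v w" for u v w
  proof -
    obtain X where u: "u \<in> hom C X B" and v: "v \<in> hom C X B" using related_hom[OF span uv] .
    have w: "w \<in> hom C X B" using related_hom[OF span vw] v by (metis homD(2))
    \<comment> \<open>Three successive covers lift \<open>u\<close>, \<open>v\<close> and
      \<open>w\<close> to a common stage. Transitivity of \<open>r\<close> is used there, and the
      result descends along the covers one by one.\<close>
    obtain Y c a where c: "regular_epi C c" "c \<in> hom C Y X" and a: "a \<in> hom C Y A" "q \<cdot> a = u \<cdot> c"
      using regular_epi_lift[OF q u] .
    obtain Y' c' b where c': "regular_epi C c'" "c' \<in> hom C Y' Y" and b: "b \<in> hom C Y' A" "q \<cdot> b = (v \<cdot> c) \<cdot> c'"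
      using regular_epi_lift[OF q Comp_hom[OF c(2) v]] .
    obtain Y'' c'' d where c'': "regular_epi C c''" "c'' \<in> hom C Y'' Y'" and d: "d \<in> hom C Y'' A" "q \<cdot> d = ((w \<cdot> c) \<cdot> c') \<cdot> c''"
      using regular_epi_lift[OF q Comp_hom[OF c'(2) Comp_hom[OF c(2) w]]] .
    note a' = Comp_hom[OF c''(2) Comp_hom[OF c'(2) a(1)]] and b' = Comp_hom[OF c''(2) b(1)]
    have qa: "q \<cdot> ((a \<cdot> c') \<cdot> c'') = ((u \<cdot> c) \<cdot> c') \<cdot> c''"
      using Comp_assoc[OF c''(2) Comp_hom[OF c'(2) a(1)] q(2)] Comp_assoc[OF c'(2) a(1) q(2)] a(2) by simp
    have qb: "q \<cdot> (b \<cdot> c'') = ((v \<cdot> c) \<cdot> c') \<cdot> c''"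
      using Comp_assoc[OF c''(2) b(1) q(2)] b(2) by simp
    have uv': "related C B s (((u \<cdot> c) \<cdot> c') \<cdot> c'') (((v \<cdot> c) \<cdot> c') \<cdot> c'')"
      using uv by (auto intro!: related_comp[OF span] c c' c'' Comp_hom u v)
    have vw': "related C B s (((v \<cdot> c) \<cdot> c') \<cdot> c'') (((w \<cdot> c) \<cdot> c') \<cdot> c'')"
      using vw by (auto intro!: related_comp[OF span] c c' c'' Comp_hom v w)
    have "related C A r ((a \<cdot> c') \<cdot> c'') d"
      using uv' vw' image[OF a' b'] image[OF b' d(1)] qa qb d(2) r(5) by metis
    then have "related C B s (((u \<cdot> c) \<cdot> c') \<cdot> c'') (((w \<cdot> c) \<cdot> c') \<cdot> c'')"
      using image[OF a' d(1)] qa d(2) by simp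
    from related_descend[OF rel _ _ c'' this]
    have "related C B s ((u \<cdot> c) \<cdot> c') ((w \<cdot> c) \<cdot> c')"
      using c c' u w by (blast intro: Comp_hom)
    from related_descend[OF rel _ _ c' this]
    have "related C B s (u \<cdot> c) (w \<cdot> c)"
      using c u w by (blast intro: Comp_hom)
    from related_descend[OF rel u w c this] show ?thesis .
  qed
  have antisym: "u = v" if uv: "related C B s u v" and vu: "related C B s v u" for u v
  proof -
    obtain X where u: "u \<in> hom C X B" and v: "v \<in> hom C X B" using related_hom[OF span uv] .
    obtain Y c a where c: "regular_epi C c" "c \<in> hom C Y X" and a: "a \<in> hom C Y A" "q \<cdot> a = u \<cdot> c"
      using regular_epi_lift[OF q u] .
    obtain Y' c' b where c': "regular_epi C c'" "c' \<in> hom C Y' Y" and b: "b \<in> hom C Y' A" "q \<cdot> b = (v \<cdot> c) \<cdot> c'"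
      using regular_epi_lift[OF q Comp_hom[OF c(2) v]] .
    note a' = Comp_hom[OF c'(2) a(1)]
    have qa: "q \<cdot> (a \<cdot> c') = (u \<cdot> c) \<cdot> c'"
      using Comp_assoc[OF c'(2) a(1) q(2)] a(2) by simp
    have "related C B s ((u \<cdot> c) \<cdot> c') ((v \<cdot> c) \<cdot> c')" "related C B s ((v \<cdot> c) \<cdot> c') ((u \<cdot> c) \<cdot> c')"
      using uv vu by (auto intro!: related_comp[OF span] c c' Comp_hom u v)
    \<comment> \<open>The two lifts are related both ways in \<open>r\<close>, which is exactly when
      \<open>q\<close> identifies them. Cancelling the two covers then gives
      \<open>u = v\<close>.\<close>
    then have "q \<cdot> (a \<cdot> c') = q \<cdot> b"
      using ker[OF a' b(1)] image[OF a' b(1)] image[OF b(1) a'] qa b(2) by simp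
    then have "(u \<cdot> c) \<cdot> c' = (v \<cdot> c) \<cdot> c'" using qa b(2) by simp
    from regular_epi_cancel[OF c' Comp_hom[OF c(2) u] Comp_hom[OF c(2) v] this]
    show ?thesis by (rule regular_epi_cancel[OF c u v])
  qed
  have "internal_partial_order C B s"
    unfolding internal_partial_order_iff internal_preorder_iff using rel refl trans antisym by blast
  then show thesis using that q ker image by blast
qed


section \<open>The short exact sequence of a preorder\<close>

text \<open>Triviality means identifying related elements. After composing with \<open>q\<close>
  this says that an arrow is monotone into \<open>e\<close>, giving the kernel; after restriction to
  \<open>e\<close> it says that an arrow coequalizes the kernel pair of \<open>q\<close>, giving the
  cokernel.\<close>

lemma short_N_exact_quotient:
  assumes r: "internal_preorder C A r"
    and q: "regular_epi C q" "q \<in> hom C A B"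
    and quot: "\<forall>X. \<forall>x\<in>hom C X A. \<forall>y\<in>hom C X A.
      q \<cdot> x = q \<cdot> y \<longleftrightarrow> related C A r x y \<and> related C A r y x"
    and s: "internal_preorder C B s"
    and embed: "\<forall>X. \<forall>x\<in>hom C X A. \<forall>y\<in>hom C X A.
      related C B s (q \<cdot> x) (q \<cdot> y) \<longleftrightarrow> related C A r x y"
  defines "e \<equiv> sub_inter C r (opp C A r)"
  shows "preord_arrow C A e (Id C A) A r \<in> hom (PreOrd C) (A, e) (A, r)"
    and "preord_arrow C A r q B s \<in> hom (PreOrd C) (A, r) (B, s)"
    and "short_N_exact (PreOrd C) (trivial_ars (PreOrd C) (Eq_sub C \<inter> ParOrd_sub C))
      (preord_arrow C A e (Id C A) A r) (preord_arrow C A r q B s)"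
proof -
  let ?N = "trivial_ars (PreOrd C) (Eq_sub C \<inter> ParOrd_sub C)"
  let ?i = "preord_arrow C A e (Id C A) A r" and ?q = "preord_arrow C A r q B s"
  note ker = quot[rule_format] and image = embed[rule_format]
  note rD = internal_preorderD[OF r] and sD = internal_preorderD[OF s]
  have e: "internal_preorder C A e"
    using symmetric_part_equivalence[OF r] by (simp add: internal_equivalence_def e_def)
  have rel_e: "related C A e x y \<longleftrightarrow> related C A r x y \<and> related C A r y x" for x y
    unfolding e_def related_inter[OF rD(2) endospan_opp[OF rD(2)]] related_opp[OF rD(2)] ..
  have i: "monotone_ar C A e (Id C A) A r"
    using monotone_ar_Id[OF r] by (simp add: monotone_ar_def rel_e)
  have "related C B s (q \<cdot> x) (q \<cdot> y)" if xy: "related C A r x y" for x y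
    using related_hom[OF rD(2) xy] image xy by metis
  then have q_mono: "monotone_ar C A r q B s"
    using q(2) by (simp add: monotone_ar_def)
  show i_hom: "?i \<in> hom (PreOrd C) (A, e) (A, r)" by (rule preord_arrow_hom[OF e r i])
  show q_hom: "?q \<in> hom (PreOrd C) (A, r) (B, s)" by (rule preord_arrow_hom[OF r s q_mono])
  have ars: "?i \<in> Ar (PreOrd C)" "?q \<in> Ar (PreOrd C)"
    using i_hom q_hom by (simp_all add: hom_def)
  have "q \<cdot> x = q \<cdot> y" if xy: "related C A e x y" for x y
  proof -
    have "related C A r x y" using xy rel_e by blast
    then obtain X where "x \<in> hom C X A" "y \<in> hom C X A" by (rule related_hom[OF rD(2)])
    then show ?thesis using ker xy rel_e by blast
  qed
  then have qi: "?q \<cdot>\<^bsub>PreOrd C\<^esub> ?i \<in> ?N"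
    unfolding preord_arrow_Comp[OF e r s i q_mono] Comp_Id[OF q(2)]
    using trivial_ars_iff[OF e s] monotone_ar_Comp[OF e i q_mono] Comp_Id[OF q(2)] by simp
  have "\<exists>!l'. l' \<in> hom (PreOrd C) X (A, e) \<and> l = ?i \<cdot>\<^bsub>PreOrd C\<^esub> l'"
    if l: "l \<in> hom (PreOrd C) X (A, r)" "?q \<cdot>\<^bsub>PreOrd C\<^esub> l \<in> ?N" for X l
  proof -
    obtain D d where X: "X = (D, d)" by (cases X)
    obtain f where d: "internal_preorder C D d" and f: "monotone_ar C D d f A r"
      and l_eq: "l = preord_arrow C D d f A r"
      using l(1) X PreOrd_hom_iff by blast
    note f' = monotone_ar_hom[OF f]
    have qf: "(q \<cdot> f) \<cdot> x = (q \<cdot> f) \<cdot> y" if "related C D d x y" for x y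
      using l(2) that trivial_ars_iff[OF d s monotone_ar_Comp[OF d f q_mono]]
      unfolding l_eq preord_arrow_Comp[OF d r s f q_mono] by blast
    \<comment> \<open>Triviality of the composite makes \<open>q\<close> identify
      \<open>f \<cdot> x\<close> and \<open>f \<cdot> y\<close>, and the kernel pair of
      \<open>q\<close> is \<open>e\<close>.\<close>
    have "related C A e (f \<cdot> x) (f \<cdot> y)" if xy: "related C D d x y" for x y
    proof -
      obtain W where x: "x \<in> hom C W D" and y: "y \<in> hom C W D"
        using related_hom[OF internal_preorderD(2)[OF d] xy] .
      have "q \<cdot> (f \<cdot> x) = q \<cdot> (f \<cdot> y)"
        using qf[OF xy] Comp_assoc[OF x f' q(2)] Comp_assoc[OF y f' q(2)] by simp
      then show ?thesis
        using ker[OF Comp_hom[OF x f'] Comp_hom[OF y f']] by (simp add: rel_e)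
    qed
    then have g: "monotone_ar C D d f A e" using f' by (simp add: monotone_ar_def)
    \<comment> \<open>The inclusion has an identity as underlying arrow, so composing with it
      changes only the target relation. This settles both existence and uniqueness of the
      factorization.\<close>
    have comp: "?i \<cdot>\<^bsub>PreOrd C\<^esub> preord_arrow C D d h A e = preord_arrow C D d h A r"
      if h: "monotone_ar C D d h A e" for h
      using preord_arrow_Comp[OF d e r h i] Id_Comp[OF monotone_ar_hom[OF h]] by simp
    show ?thesis
    proof (rule ex1I[of _ "preord_arrow C D d f A e"])
      show "preord_arrow C D d f A e \<in> hom (PreOrd C) X (A, e) \<and>
          l = ?i \<cdot>\<^bsub>PreOrd C\<^esub> preord_arrow C D d f A e"
        using preord_arrow_hom[OF d e g] comp[OF g] X l_eq by simp
    next
      fix l' assume l': "l' \<in> hom (PreOrd C) X (A, e) \<and> l = ?i \<cdot>\<^bsub>PreOrd C\<^esub> l'"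
      then obtain h where h: "monotone_ar C D d h A e" "l' = preord_arrow C D d h A e"
        using X PreOrd_hom_iff by blast
      then show "l' = preord_arrow C D d f A e"
        using l' comp[OF h(1)] l_eq by simp
    qed
  qed
  then have kernel: "N_kernel (PreOrd C) ?N ?q ?i"
    unfolding N_kernel_def preord_arrow_simps using ars qi by blast
  have "\<exists>!l'. l' \<in> hom (PreOrd C) (B, s) Y \<and> l = l' \<cdot>\<^bsub>PreOrd C\<^esub> ?q"
    if l: "l \<in> hom (PreOrd C) (A, r) Y" "l \<cdot>\<^bsub>PreOrd C\<^esub> ?i \<in> ?N" for Y l
  proof -
    obtain D d where Y: "Y = (D, d)" by (cases Y)
    obtain f where d: "internal_preorder C D d" and f: "monotone_ar C A r f D d"
      and l_eq: "l = preord_arrow C A r f D d"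
      using l(1) Y PreOrd_hom_iff by blast
    note f' = monotone_ar_hom[OF f]
    have fe: "f \<cdot> x = f \<cdot> y" if "related C A e x y" for x y
      using l(2) that trivial_ars_iff[OF e d monotone_ar_Comp[OF e i f]]
      unfolding l_eq preord_arrow_Comp[OF e r d i f] Comp_Id[OF f'] by blast
    obtain a R b where ab: "a \<in> hom C R A" "b \<in> hom C R A" "q \<cdot> a = q \<cdot> b"
      and coeq: "\<forall>Z. \<forall>h\<in>hom C A Z. h \<cdot> a = h \<cdot> b \<longrightarrow> (\<exists>!u. u \<in> hom C B Z \<and> u \<cdot> q = h)"
      by (rule regular_epi_coequalizer[OF q])
    \<comment> \<open>The pair that \<open>q\<close> coequalizes lies in its kernel pair
      \<open>e\<close>, so \<open>f\<close> identifies it and factors through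
      \<open>q\<close>.\<close>
    have "related C A e a b" using ker[OF ab(1,2)] ab(3) rel_e by blast
    then obtain g where g: "g \<in> hom C B D" "g \<cdot> q = f"
      using coeq f' fe by blast
    \<comment> \<open>For monotonicity of \<open>g\<close>, lift \<open>u\<close> and
      \<open>v\<close> to \<open>A\<close> on a cover. There \<open>g\<close> after \<open>q\<close>
      is the monotone \<open>f\<close>, and the resulting relation in \<open>d\<close>
      descends.\<close>
    have "related C D d (g \<cdot> u) (g \<cdot> v)" if uv: "related C B s u v" for u v
    proof -
      obtain W where u: "u \<in> hom C W B" and v: "v \<in> hom C W B" using related_hom[OF sD(2) uv] .
      obtain W' c a where c: "regular_epi C c" "c \<in> hom C W' W" and a: "a \<in> hom C W' A" "q \<cdot> a = u \<cdot> c"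
        using regular_epi_lift[OF q u] .
      note vc = Comp_hom[OF c(2) v] and uc = Comp_hom[OF c(2) u]
      obtain W'' c' b where c': "regular_epi C c'" "c' \<in> hom C W'' W'" and b: "b \<in> hom C W'' A" "q \<cdot> b = (v \<cdot> c) \<cdot> c'"
        using regular_epi_lift[OF q vc] .
      note ac' = Comp_hom[OF c'(2) a(1)]
      have qa: "q \<cdot> (a \<cdot> c') = (u \<cdot> c) \<cdot> c'"
        using Comp_assoc[OF c'(2) a(1) q(2)] a(2) by simp
      have "related C B s (u \<cdot> c) (v \<cdot> c)" using related_comp[OF sD(2) uv _ c(2)] u by blast
      then have "related C B s ((u \<cdot> c) \<cdot> c') ((v \<cdot> c) \<cdot> c')" using related_comp[OF sD(2) _ _ c'(2)] uc by blast
      then have "related C A r (a \<cdot> c') b" using image[OF ac' b(1)] qa b(2) by simp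
      then have "related C D d (f \<cdot> (a \<cdot> c')) (f \<cdot> b)" by (rule monotone_ar_related[OF f])
      moreover have "f \<cdot> (a \<cdot> c') = ((g \<cdot> u) \<cdot> c) \<cdot> c'"
        using Comp_assoc[OF ac' q(2) g(1)] g(2) qa Comp_assoc[OF c'(2) uc g(1)] Comp_assoc[OF c(2) u g(1)] by simp
      moreover have "f \<cdot> b = ((g \<cdot> v) \<cdot> c) \<cdot> c'"
        using Comp_assoc[OF b(1) q(2) g(1)] g(2) b(2) Comp_assoc[OF c'(2) vc g(1)] Comp_assoc[OF c(2) v g(1)] by simp
      ultimately have rel: "related C D d (((g \<cdot> u) \<cdot> c) \<cdot> c') (((g \<cdot> v) \<cdot> c) \<cdot> c')" by simp
      note gu = Comp_hom[OF u g(1)] and gv = Comp_hom[OF v g(1)]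
      note D = internal_preorderD(1)[OF d]
      show ?thesis
        by (rule related_descend[OF D gu gv c
            related_descend[OF D Comp_hom[OF c(2) gu] Comp_hom[OF c(2) gv] c' rel]])
    qed
    then have g_mono: "monotone_ar C B s g D d" using g(1) by (simp add: monotone_ar_def)
    have comp: "preord_arrow C B s h D d \<cdot>\<^bsub>PreOrd C\<^esub> ?q = preord_arrow C A r (h \<cdot> q) D d"
      if h: "monotone_ar C B s h D d" for h
      by (rule preord_arrow_Comp[OF r s d q_mono h])
    show ?thesis
    proof (rule ex1I[of _ "preord_arrow C B s g D d"])
      show "preord_arrow C B s g D d \<in> hom (PreOrd C) (B, s) Y \<and>
          l = preord_arrow C B s g D d \<cdot>\<^bsub>PreOrd C\<^esub> ?q"
        using preord_arrow_hom[OF s d g_mono] comp[OF g_mono] Y l_eq g(2) by simp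
    next
      fix l' assume l': "l' \<in> hom (PreOrd C) (B, s) Y \<and> l = l' \<cdot>\<^bsub>PreOrd C\<^esub> ?q"
      then obtain h where h: "monotone_ar C B s h D d" "l' = preord_arrow C B s h D d"
        using Y PreOrd_hom_iff by blast
      then have "h \<cdot> q = g \<cdot> q"
        using l' comp[OF h(1)] l_eq g(2) by simp
      then show "l' = preord_arrow C B s g D d"
        using regular_epi_cancel[OF q monotone_ar_hom[OF h(1)] g(1)] h(2) by simp
    qed
  qed
  then have "N_cokernel (PreOrd C) ?N ?i ?q"
    unfolding N_cokernel_def preord_arrow_simps using ars qi by blast
  then show "short_N_exact (PreOrd C) ?N ?i ?q"
    using kernel by (simp add: short_N_exact_def)
qed

end

section \<open>Verification of the pretorsion axioms\<close>

theorem lemma1p3: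
  fixes C :: "('o, 'a) cat"
  assumes "exact_category C"
  shows "pretorsion_theory (PreOrd C) (Eq_sub C) (ParOrd_sub C)"
proof -
  interpret barr_exact C by (rule barr_exact.intro[OF assms])
  let ?N = "trivial_ars (PreOrd C) (Eq_sub C \<inter> ParOrd_sub C)"
  have torsion: "\<phi> \<in> ?N"
    if X: "X \<in> Eq_sub C" and Y: "Y \<in> ParOrd_sub C" and \<phi>: "\<phi> \<in> hom (PreOrd C) X Y" for X Y \<phi>
  proof -
    obtain A r B s f where *: "X = (A, r)" "Y = (B, s)" "internal_preorder C A r" "internal_preorder C B s"
      and f: "monotone_ar C A r f B s" "\<phi> = preord_arrow C A r f B s"
      using PreOrd_homE[OF \<phi>] .
    \<comment> \<open>Symmetry of \<open>r\<close> makes the images related both ways in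
      \<open>s\<close>, and antisymmetry of \<open>s\<close> identifies them.\<close>
    have "Comp C f x = Comp C f y" if xy: "related C A r x y" for x y
    proof -
      have "related C A r y x"
        using X xy * by (simp add: Eq_sub_def internal_equivalence_iff)
      then show ?thesis
        using Y * monotone_ar_related[OF f(1) xy] monotone_ar_related[OF f(1)]
        by (simp add: ParOrd_sub_def internal_partial_order_iff)
    qed
    then show ?thesis using trivial_ars_iff[OF *(3,4) f(1)] f(2) by blast
  qed
  have exact_seq: "\<exists>TX\<in>Eq_sub C. \<exists>FX\<in>ParOrd_sub C. \<exists>f\<in>hom (PreOrd C) TX X. \<exists>g\<in>hom (PreOrd C) X FX.
      short_N_exact (PreOrd C) ?N f g" if X: "X \<in> Ob (PreOrd C)" for X
  proof -
    obtain A r where Ar: "X = (A, r)" by (cases X)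
    then have r: "internal_preorder C A r" using X by (simp add: PreOrd_Ob)
    obtain B q s where q: "regular_epi C q" "q \<in> hom C A B"
      and ker: "\<forall>X. \<forall>x\<in>hom C X A. \<forall>y\<in>hom C X A. Comp C q x = Comp C q y \<longleftrightarrow>
        related C A r x y \<and> related C A r y x"
      and s: "internal_partial_order C B s"
      and image: "\<forall>X. \<forall>x\<in>hom C X A. \<forall>y\<in>hom C X A. related C B s (Comp C q x) (Comp C q y) \<longleftrightarrow>
        related C A r x y"
      by (rule quotient_partial_order[OF r])
    have s': "internal_preorder C B s" using s by (simp add: internal_partial_order_def)
    note exact = short_N_exact_quotient[OF r q ker s' image]
    have "(A, sub_inter C r (opp C A r)) \<in> Eq_sub C" "(B, s) \<in> ParOrd_sub C"
      using symmetric_part_equivalence[OF r] s by (simp_all add: Eq_sub_def ParOrd_sub_def)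
    then show ?thesis using exact Ar by blast
  qed
  show ?thesis
    unfolding pretorsion_theory_def Let_def
    using category_PreOrd replete_Eq_sub replete_ParOrd_sub torsion exact_seq by blast
qed

end
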